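(* Let $\mathbf m=(m_0,\dots,m_{e-1})$ be positive integers and $1\le r\le M_1=\min_k m_k$. (i) For $\alpha\in\mathcal P_{\mathbf m}$, $$D^r_{\pm}(q,t)\,m_\alpha(x)=\sum_{\beta}\sum_{J\in\mathcal I_r}t^{\langle\delta,J\rangle}q^{\langle\beta,J\rangle}\,s_{(\beta+\delta)_{J\pm}-\delta}(x),$$ where $\beta\in Z$ runs over all the (distinct) row permutations of $\alpha$. (ii) For $\alpha\in\mathcal P_{\mathbf m}$ of size $n$, $$D^r_{\pm}(q,t)\,m_\alpha(x)=\sum_{\beta\in Z_n^{0,0}}b^{r,\pm}_{\alpha,\beta}(q,t)\,m_\beta(x)$$ with $b^{r,\pm}_{\alpha,\beta}(q,t)\in F$, where $b^{r,\pm}_{\alpha,\beta}(q,t)=0$ unless $\beta\sim\alpha$ or $\beta<\alpha$. In particular, $D^r_{\pm}$ is an operator on the space $\Xi_{\mathbf m,F}$.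
   Context: **Notation.** $e\ge1$; $F=\mathbb C(q,t)$; variables $x=(x^{(k)}_j)$, $0\le k\le e-1$, $1\le j\le m_k$, upper indices read mod $e$. $\mathfrak S_{\mathbf m}=\prod_k\mathfrak S_{m_k}$ permutes the variables within each $k$, with sign character $\varepsilon$; $\Xi_{\mathbf m,F}=F[x]^{\mathfrak S_{\mathbf m}}$. $Z$ is the set of arrays $\beta=(\beta^{(k)}_j)$ ($0\le k\le e-1,\ 1\le j\le m_k$) of nonnegative integers, with rows $\beta^{(k)}$; $x^\beta=\prod(x^{(k)}_j)^{\beta^{(k)}_j}$; $\mathfrak S_{\mathbf m}$ acts on $Z$ with $w(x^\beta)=x^{w(\beta)}$. A row permutation of $\alpha$ is an element $w(\alpha)$, $w\in\mathfrak S_{\mathbf m}$. $Z_n^{0,0}$ is the set of $\alpha\in Z$ with weakly decreasing rows and sum of entries $n$; $\mathcal P_{\mathbf m}=\bigcup_{n\ge 0} Z_n^{0,0}$. $m_\alpha(x)=\prod_k m_{\alpha^{(k)}}(x^{(k)})$ (monomial symmetric polynomials). $\delta=(\delta^{(k)})\in Z$ with $\delta^{(k)}=(m_k-1,\dots,1,0)$. $a_\beta(x)=\sum_{w\in\mathfrak S_{\mathbf m}}\varepsilon(w)w(x^\beta)$ for $\beta\in Z$, and $s_\gamma(x)=a_{\gamma+\delta}(x)/a_\delta(x)$ for any integer array $\gamma$ with $\gamma+\delta\in Z$ (this is the product of Schur polynomials $\prod_k s_{\gamma^{(k)}}(x^{(k)})$ when the rows of $\gamma$ are partitions). **Index sets.**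 $\mathcal I=\{\mathbf i=(i_0,\dots,i_{e-1})\in\mathbb Z^e\mid1\le i_k\le m_k\}$. $\mathcal I_r$ is the set of $J=\{\mathbf i_1,\dots,\mathbf i_r\}\subset\mathcal I$ such that for $a\neq b$ the vector $\mathbf i_a-\mathbf i_b$ has no zero entry; $J$ is also regarded as the set of positions $(k,j)$ with $j$ the $k$-th entry of some $\mathbf i_a$. For $\mathbf i\in\mathcal I$ and $u\in F$, $T^{\pm}_{u,\mathbf i}$ is the $F$-algebra endomorphism of $F[x]$ replacing simultaneously $x^{(k)}_{i_k}$ by $u\,x^{(k\mp1)}_{i_{k\mp1}}$ for all $k$ (indices mod $e$) and fixing the other variables; $T^\pm_{u,J}=\prod_{a=1}^rT^\pm_{u,\mathbf i_a}$. For $\beta\in Z$, $\langle\beta,J\rangle=\sum_{(k,j)\in J}\beta^{(k)}_j$, and $\beta_{J\pm}\in Z$ is the array (a permutation of the entries of $\beta$) with $T^{\pm}_{q,J}x^\beta=q^{\langle\beta,J\rangle}x^{\beta_{J\pm}}$. **Operators.** $$D^r_{\pm}(q,t)=a_\delta(x)^{-1}\sum_{w\in\mathfrak S_{\mathbf m}}\varepsilon(w)\sum_{J\in\mathcal I_r}x^{w(\delta)_{J\pm}}\,t^{\langle w(\delta),J\rangle}\,T^{\pm}_{q,J},$$ an $F$-linear operator defined on $F[x]$ (a priori with values in the fraction field of $F[x]$). **Orders.** For $\alpha\in Z_n^{0,0}$ put $\Lambda(\alpha)=\alpha+\delta$ (its symbol of type $(1,0)$). $\alpha\sim\beta$ if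 the multisets of all entries of $\Lambda(\alpha)$ and $\Lambda(\beta)$ coincide. Let $\lambda(\alpha)$ be the partition obtained by arranging all entries of $\Lambda(\alpha)$ in weakly decreasing order; $\beta<\alpha$ means $\lambda(\beta)\neq\lambda(\alpha)$ and $\lambda(\beta)$ is smaller than $\lambda(\alpha)$ in the dominance order. *)

theory Defs
  imports
    "HOL-Library.Poly_Mapping"
    "HOL-Library.Product_Lexorder"
    "HOL-Library.FuncSet"
    "HOL-Combinatorics.Permutations"
    "HOL-Computational_Algebra.Polynomial_Factorial"
begin

text \<open>
  The variable \<open>x^(k)_j\<close> is indexed by the pair \<open>(k, j)\<close>, with \<open>0 \<le> k < e\<close> and \<open>1 \<le> j \<le> m k\<close>.
  An array of nonnegative integers, equivalently the exponent of a monomial, is a finitely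
  supported function on such pairs. The lexicographic order on pairs serves only to obtain the
  type class instance saying that polynomials form an integral domain. Each notion below is
  relative to \<open>e\<close> and \<open>m\<close>; values \<open>m k\<close> with \<open>k \<ge> e\<close> play no role.
\<close>

type_synonym ratqt = "complex poly poly fract"
type_synonym array = "nat \<times> nat \<Rightarrow>\<^sub>0 nat"
type_synonym xpoly = "array \<Rightarrow>\<^sub>0 ratqt"

text \<open>The inner polynomial variable is \<open>q\<close>, the outer one is \<open>t\<close>.\<close>

definition qq :: ratqt where "qq = to_fract [:[:0, 1:]:]"
definition tt :: ratqt where "tt = to_fract [:0, 1:]"

definition const :: "ratqt \<Rightarrow> xpoly" where
  "const c = Poly_Mapping.single 0 c"

definition xmon :: "array \<Rightarrow> xpoly" where
  "xmon \<beta> = Poly_Mapping.single \<beta> 1"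

definition var :: "nat \<times> nat \<Rightarrow> xpoly" where
  "var p = xmon (Poly_Mapping.single p 1)"

text \<open>The \<open>F\<close>-algebra endomorphism with \<open>x_p \<mapsto> \<sigma> p\<close>.\<close>

definition subst :: "(nat \<times> nat \<Rightarrow> xpoly) \<Rightarrow> xpoly \<Rightarrow> xpoly" where
  "subst \<sigma> f = (\<Sum>\<mu>\<in>Poly_Mapping.keys f. const (Poly_Mapping.lookup f \<mu>) *
     (\<Prod>p\<in>Poly_Mapping.keys \<mu>. \<sigma> p ^ Poly_Mapping.lookup \<mu> p))"

definition positions :: "nat \<Rightarrow> (nat \<Rightarrow> nat) \<Rightarrow> (nat \<times> nat) set" where
  "positions e m = (SIGMA k:{..<e}. {1..m k})"

definition arrays :: "nat \<Rightarrow> (nat \<Rightarrow> nat) \<Rightarrow> array set" where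
  "arrays e m = {\<beta>. Poly_Mapping.keys \<beta> \<subseteq> positions e m}"

definition polys :: "nat \<Rightarrow> (nat \<Rightarrow> nat) \<Rightarrow> xpoly set" where
  "polys e m = {f. Poly_Mapping.keys f \<subseteq> arrays e m}"

text \<open>
  An element of the product of symmetric groups is encoded as the permutation of all positions
  preserving each row; the product of the signs of its components is the sign of this permutation.
\<close>

definition row_group :: "nat \<Rightarrow> (nat \<Rightarrow> nat) \<Rightarrow> (nat \<times> nat \<Rightarrow> nat \<times> nat) set" where
  "row_group e m = {w. w permutes positions e m \<and> (\<forall>p. fst (w p) = fst p)}"

definition act_poly :: "(nat \<times> nat \<Rightarrow> nat \<times> nat) \<Rightarrow> xpoly \<Rightarrow> xpoly" where
  "act_poly w = subst (\<lambda>p. var (w p))"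

text \<open>\<open>w(\<beta>)\<close> has entry \<open>\<beta>_p\<close> at position \<open>w p\<close>, so that \<open>w(x^\<beta>) = x^{w(\<beta>)}\<close>.\<close>

definition act_array :: "(nat \<times> nat \<Rightarrow> nat \<times> nat) \<Rightarrow> array \<Rightarrow> array" where
  "act_array w \<beta> = Poly_Mapping.map_key (inv w) \<beta>"

definition symm_polys :: "nat \<Rightarrow> (nat \<Rightarrow> nat) \<Rightarrow> xpoly set" where
  "symm_polys e m = {f \<in> polys e m. \<forall>w\<in>row_group e m. act_poly w f = f}"

definition row_perms :: "nat \<Rightarrow> (nat \<Rightarrow> nat) \<Rightarrow> array \<Rightarrow> array set" where
  "row_perms e m \<alpha> = (\<lambda>w. act_array w \<alpha>) ` row_group e m"

definition partition_arrays :: "nat \<Rightarrow> (nat \<Rightarrow> nat) \<Rightarrow> nat \<Rightarrow> array set" where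
  "partition_arrays e m n = {\<alpha> \<in> arrays e m.
     (\<forall>k<e. \<forall>i j. 1 \<le> i \<longrightarrow> i \<le> j \<longrightarrow> j \<le> m k \<longrightarrow>
        Poly_Mapping.lookup \<alpha> (k, j) \<le> Poly_Mapping.lookup \<alpha> (k, i)) \<and>
     (\<Sum>p\<in>positions e m. Poly_Mapping.lookup \<alpha> p) = n}"

definition multipartitions :: "nat \<Rightarrow> (nat \<Rightarrow> nat) \<Rightarrow> array set" where
  "multipartitions e m = (\<Union>n. partition_arrays e m n)"

text \<open>
  The monomial symmetric polynomial in the finite set \<open>V\<close> of variables is the sum of the distinct
  monomials obtained from \<open>x^\<nu>\<close> by permuting \<open>V\<close>.
\<close>

definition monomial_symm :: "(nat \<times> nat) set \<Rightarrow> array \<Rightarrow> xpoly" where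
  "monomial_symm V \<nu> = (\<Sum>\<beta>\<in>(\<lambda>w. act_array w \<nu>) ` {w. w permutes V}. xmon \<beta>)"

definition row :: "(nat \<Rightarrow> nat) \<Rightarrow> nat \<Rightarrow> array \<Rightarrow> array" where
  "row m k \<alpha> = (\<Sum>j=1..m k. Poly_Mapping.single (k, j) (Poly_Mapping.lookup \<alpha> (k, j)))"

definition msym :: "nat \<Rightarrow> (nat \<Rightarrow> nat) \<Rightarrow> array \<Rightarrow> xpoly" where
  "msym e m \<alpha> = (\<Prod>k<e. monomial_symm ({k} \<times> {1..m k}) (row m k \<alpha>))"

definition delta :: "nat \<Rightarrow> (nat \<Rightarrow> nat) \<Rightarrow> array" where
  "delta e m = (\<Sum>(k, j)\<in>positions e m. Poly_Mapping.single (k, j) (m k - j))"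

definition antisymm :: "nat \<Rightarrow> (nat \<Rightarrow> nat) \<Rightarrow> array \<Rightarrow> xpoly" where
  "antisymm e m \<beta> = (\<Sum>w\<in>row_group e m. of_int (sign w) * act_poly w (xmon \<beta>))"

definition int_array :: "array \<Rightarrow> (nat \<times> nat \<Rightarrow>\<^sub>0 int)" where
  "int_array \<beta> = Poly_Mapping.map int \<beta>"

text \<open>
  The integer array \<open>\<gamma>\<close> may have negative entries; the value is meaningful only if \<open>\<gamma> + \<delta>\<close> has
  nonnegative entries, in which case the truncation \<open>nat\<close> is just the conversion between types.
\<close>

definition schur :: "nat \<Rightarrow> (nat \<Rightarrow> nat) \<Rightarrow> (nat \<times> nat \<Rightarrow>\<^sub>0 int) \<Rightarrow> xpoly fract" where
  "schur e m \<gamma> =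
     to_fract (antisymm e m (Poly_Mapping.map nat (\<gamma> + int_array (delta e m))))
     / to_fract (antisymm e m (delta e m))"

definition indices :: "nat \<Rightarrow> (nat \<Rightarrow> nat) \<Rightarrow> (nat \<Rightarrow> nat) set" where
  "indices e m = (\<Pi>\<^sub>E k\<in>{..<e}. {1..m k})"

definition index_sets :: "nat \<Rightarrow> (nat \<Rightarrow> nat) \<Rightarrow> nat \<Rightarrow> (nat \<Rightarrow> nat) set set" where
  "index_sets e m r = {J. J \<subseteq> indices e m \<and> card J = r \<and>
     (\<forall>a\<in>J. \<forall>b\<in>J. a \<noteq> b \<longrightarrow> (\<forall>k<e. a k \<noteq> b k))}"

definition cells :: "nat \<Rightarrow> (nat \<Rightarrow> nat) set \<Rightarrow> (nat \<times> nat) set" where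
  "cells e J = {(k, i k) | k i. k < e \<and> i \<in> J}"

definition pairing :: "nat \<Rightarrow> array \<Rightarrow> (nat \<Rightarrow> nat) set \<Rightarrow> nat" where
  "pairing e \<beta> J = (\<Sum>p\<in>cells e J. Poly_Mapping.lookup \<beta> p)"

text \<open>
  The sign \<open>\<plusminus>\<close> is an integer \<open>s \<in> {1, -1}\<close>; then \<open>k \<mp> 1\<close> modulo \<open>e\<close> is \<open>prev e s k\<close>.
\<close>

definition prev :: "nat \<Rightarrow> int \<Rightarrow> nat \<Rightarrow> nat" where
  "prev e s k = nat ((int k - s) mod int e)"

definition T_index :: "nat \<Rightarrow> int \<Rightarrow> ratqt \<Rightarrow> (nat \<Rightarrow> nat) \<Rightarrow> xpoly \<Rightarrow> xpoly" where
  "T_index e s u i = subst (\<lambda>(k, j).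
     if k < e \<and> j = i k then const u * var (prev e s k, i (prev e s k)) else var (k, j))"

text \<open>
  For \<open>J\<close> in \<open>index_sets e m r\<close> the factors act on disjoint sets of variables and hence commute,
  so the composition over \<open>J\<close> does not depend on the order.
\<close>

definition T_set :: "nat \<Rightarrow> int \<Rightarrow> ratqt \<Rightarrow> (nat \<Rightarrow> nat) set \<Rightarrow> xpoly \<Rightarrow> xpoly" where
  "T_set e s u J = Finite_Set.fold (\<lambda>i g. T_index e s u i \<circ> g) id J"

definition shift_array :: "nat \<Rightarrow> (nat \<Rightarrow> nat) \<Rightarrow> int \<Rightarrow> (nat \<Rightarrow> nat) set \<Rightarrow> array \<Rightarrow> array" where
  "shift_array e m s J \<beta> = (THE \<gamma>. \<gamma> \<in> arrays e m \<and>
     T_set e s qq J (xmon \<beta>) = const (qq ^ pairing e \<beta> J) * xmon \<gamma>)"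

definition D_op :: "nat \<Rightarrow> (nat \<Rightarrow> nat) \<Rightarrow> int \<Rightarrow> nat \<Rightarrow> xpoly \<Rightarrow> xpoly fract" where
  "D_op e m s r f = inverse (to_fract (antisymm e m (delta e m))) *
     (\<Sum>w\<in>row_group e m. of_int (sign w) *
       (\<Sum>J\<in>index_sets e m r. to_fract
         (xmon (shift_array e m s J (act_array w (delta e m))) *
          const (tt ^ pairing e (act_array w (delta e m)) J) *
          T_set e s qq J f)))"

definition symbol :: "nat \<Rightarrow> (nat \<Rightarrow> nat) \<Rightarrow> array \<Rightarrow> array" where
  "symbol e m \<alpha> = \<alpha> + delta e m"

definition entries :: "nat \<Rightarrow> (nat \<Rightarrow> nat) \<Rightarrow> array \<Rightarrow> nat multiset" where
  "entries e m \<beta> = image_mset (Poly_Mapping.lookup \<beta>) (mset_set (positions e m))"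

definition similar :: "nat \<Rightarrow> (nat \<Rightarrow> nat) \<Rightarrow> array \<Rightarrow> array \<Rightarrow> bool" where
  "similar e m \<alpha> \<beta> \<longleftrightarrow> entries e m (symbol e m \<alpha>) = entries e m (symbol e m \<beta>)"

definition symbol_partition :: "nat \<Rightarrow> (nat \<Rightarrow> nat) \<Rightarrow> array \<Rightarrow> nat list" where
  "symbol_partition e m \<alpha> = rev (sorted_list_of_multiset (entries e m (symbol e m \<alpha>)))"

definition dominated :: "nat list \<Rightarrow> nat list \<Rightarrow> bool" where
  "dominated \<mu> \<nu> \<longleftrightarrow> sum_list \<mu> = sum_list \<nu> \<and>
     (\<forall>i. sum_list (take i \<mu>) \<le> sum_list (take i \<nu>))"

definition symbol_less :: "nat \<Rightarrow> (nat \<Rightarrow> nat) \<Rightarrow> array \<Rightarrow> array \<Rightarrow> bool" where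
  "symbol_less e m \<beta> \<alpha> \<longleftrightarrow> symbol_partition e m \<beta> \<noteq> symbol_partition e m \<alpha> \<and>
     dominated (symbol_partition e m \<beta>) (symbol_partition e m \<alpha>)"

end

theory Submission
  imports Defs
begin

text \<open>
  Each operator \<open>T\<close> attached to a set \<open>J\<close> of index vectors permutes the variables at the cells of
  \<open>J\<close> and multiplies them by \<open>q\<close>, so it sends a monomial to a power of \<open>q\<close> times a monomial
  whose exponent array has permuted positions (\<open>T_set_xmon\<close>). This permutation is equivariant
  for the row group. After substituting \<open>w(J)\<close> for \<open>J\<close> and \<open>w(\<beta>)\<close> for the row permutations \<open>\<beta>\<close> of
  \<open>\<alpha>\<close>, the sum over \<open>w\<close> in the numerator of \<open>D m_\<alpha>\<close> turns into the alternants of the shifted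
  arrays \<open>\<beta> + \<delta>\<close> (\<open>D_numerator_orbit\<close>), and dividing by the alternant of \<open>\<delta>\<close> gives the first
  formula.

  For triangularity these alternants are rewritten as the alternant of \<open>\<delta>\<close> times combinations
  of monomial symmetric polynomials. The case \<open>r = 0\<close> of the first formula says that the alternant
  of \<open>\<delta>\<close> times \<open>m_\<kappa>\<close> is the sum of the alternants of \<open>\<beta> + \<delta>\<close> over the row permutations \<open>\<beta>\<close> of
  \<open>\<kappa>\<close>. Solving for the term with \<open>\<beta> = \<kappa>\<close> and recursing on the others expands any alternant;
  the recursion ends because the sum of the squares of the entries of \<open>\<beta> + \<delta>\<close> is
  strictly largest for \<open>\<beta> = \<kappa>\<close> (\<open>antisymm_straighten\<close>).

  The dominance order is controlled throughout by one observation: for arrays with decreasing rows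
  the sum over a set of cells only grows when the cells are pushed to the start of their rows.
  Hence \<open>\<beta> + \<delta>\<close> is dominated by \<open>\<kappa> + \<delta>\<close> (\<open>majorized_permuted_plus_delta\<close>), while
  permuting positions, whether for sorting or for shifting along \<open>J\<close>, leaves the multiset of
  entries unchanged. Finally, every symmetric polynomial is a combination of the \<open>m_\<alpha>\<close>, so the
  operator maps symmetric polynomials to symmetric polynomials.
\<close>

section \<open>Linear operators on polynomials\<close>

lemma const_mult_xmon: "const c * xmon \<beta> = Poly_Mapping.single \<beta> c"
  by (simp add: const_def xmon_def mult_single)

lemma lookup_const_mult:
  "Poly_Mapping.lookup (const c * f) \<mu> = c * Poly_Mapping.lookup f \<mu>"
  unfolding const_def mult_map_scale_conv_mult[symmetric]
  by (auto simp: Poly_Mapping.map.rep_eq when_def)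

lemma lookup_xmon: "Poly_Mapping.lookup (xmon \<beta>) \<mu> = (if \<beta> = \<mu> then 1 else 0)"
  by (simp add: xmon_def lookup_single when_def)

lemma const_mult: "const (a * b) = const a * const b"
  by (simp add: const_def mult_single)

lemma const_one [simp]: "const 1 = 1"
  by (simp add: const_def)

lemma const_zero [simp]: "const 0 = 0"
  by (simp add: const_def)

lemma const_add: "const (a + b) = const a + const b"
  by (simp add: const_def single_add)

lemma const_power: "const (a ^ n) = const a ^ n"
  by (induction n) (auto simp: const_mult)

lemma const_prod: "const (prod c A) = (\<Prod>x\<in>A. const (c x))"
  by (induction A rule: infinite_finite_induct) (auto simp: const_mult)

lemma const_of_int: "const (of_int k) = of_int k"
proof -
  have nat: "const (of_nat n) = of_nat n" for n
    by (induction n) (auto simp: const_add)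
  have neg: "const (- a) = - const a" for a
    using const_add[of a "- a"] by (simp add: eq_neg_iff_add_eq_0 add.commute)
  show ?thesis
    by (cases k) (auto simp: nat neg const_add algebra_simps simp flip: minus_add_distrib)
qed

lemma xmon_zero [simp]: "xmon 0 = 1"
  by (simp add: xmon_def)

lemma xmon_add: "xmon (\<beta> + \<gamma>) = xmon \<beta> * xmon \<gamma>"
  by (simp add: xmon_def mult_single)

lemma xmon_sum: "xmon (sum g A) = (\<Prod>x\<in>A. xmon (g x))"
  by (induction A rule: infinite_finite_induct) (auto simp: xmon_add)

lemma var_power: "var p ^ n = xmon (Poly_Mapping.single p n)"
  by (induction n) (auto simp: var_def simp flip: xmon_add single_add)

lemma poly_expand:
  "f = (\<Sum>\<mu>\<in>Poly_Mapping.keys f. const (Poly_Mapping.lookup f \<mu>) * xmon \<mu>)"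
  by (rule poly_mapping_eqI)
    (auto simp: lookup_sum lookup_const_mult lookup_xmon in_keys_iff if_distrib cong: if_cong)

text \<open>
  Linear operators on polynomials are compared on monomials; the multiplicative structure of a
  substitution is needed only to evaluate it there.
\<close>

definition scalar_linear :: "(xpoly \<Rightarrow> xpoly) \<Rightarrow> bool" where
  "scalar_linear L \<longleftrightarrow> (\<forall>f g. L (f + g) = L f + L g) \<and> (\<forall>c f. L (const c * f) = const c * L f)"

lemma scalar_linearI:
  assumes "\<And>f g. L (f + g) = L f + L g" "\<And>c f. L (const c * f) = const c * L f"
  shows "scalar_linear L"
  using assms by (simp add: scalar_linear_def)

lemma linear_add: "scalar_linear L \<Longrightarrow> L (f + g) = L f + L g"
  and linear_scale: "scalar_linear L \<Longrightarrow> L (const c * f) = const c * L f"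
  by (simp_all add: scalar_linear_def)

lemma linear_sum:
  assumes "scalar_linear L"
  shows "L (sum f A) = (\<Sum>x\<in>A. L (f x))"
proof -
  have "L 0 = 0"
    using linear_scale[OF assms, of 0 0] by simp
  then show ?thesis
    by (induction A rule: infinite_finite_induct) (auto simp: linear_add[OF assms])
qed

lemma linear_comp: "scalar_linear L \<Longrightarrow> scalar_linear L' \<Longrightarrow> scalar_linear (L \<circ> L')"
  by (auto simp: scalar_linear_def)

lemma linear_id: "scalar_linear id"
  by (simp add: scalar_linear_def)

lemma linear_expand:
  assumes "scalar_linear L"
  shows "L f = (\<Sum>\<mu>\<in>Poly_Mapping.keys f. const (Poly_Mapping.lookup f \<mu>) * L (xmon \<mu>))"
  by (subst poly_expand[of f]) (simp only: linear_sum[OF assms] linear_scale[OF assms])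

lemma linear_eqI:
  assumes "scalar_linear L" "scalar_linear L'" "\<And>\<mu>. L (xmon \<mu>) = L' (xmon \<mu>)"
  shows "L = L'"
proof
  fix f
  show "L f = L' f"
    by (simp only: linear_expand[OF assms(1), of f] linear_expand[OF assms(2), of f] assms(3))
qed

lemma linear_subst: "scalar_linear (subst \<sigma>)"
proof -
  define M where "M \<mu> = (\<Prod>p\<in>Poly_Mapping.keys \<mu>. \<sigma> p ^ Poly_Mapping.lookup \<mu> p)" for \<mu> :: array
  have on: "subst \<sigma> f = (\<Sum>\<mu>\<in>A. const (Poly_Mapping.lookup f \<mu>) * M \<mu>)"
    if "finite A" "Poly_Mapping.keys f \<subseteq> A" for f A
    unfolding subst_def M_def using that
    by (intro sum.mono_neutral_left) (auto simp: in_keys_iff)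
  show ?thesis
  proof (rule scalar_linearI)
    fix f g :: xpoly
    let ?A = "Poly_Mapping.keys f \<union> Poly_Mapping.keys g"
    have "Poly_Mapping.keys (f + g) \<subseteq> ?A"
      by (rule keys_add)
    then show "subst \<sigma> (f + g) = subst \<sigma> f + subst \<sigma> g"
      using on[of ?A "f + g"] on[of ?A f] on[of ?A g]
      by (simp add: lookup_add const_add distrib_right sum.distrib)
  next
    fix c and f :: xpoly
    let ?A = "Poly_Mapping.keys f"
    have "Poly_Mapping.keys (const c * f) \<subseteq> ?A"
      by (auto simp: in_keys_iff lookup_const_mult)
    then show "subst \<sigma> (const c * f) = const c * subst \<sigma> f"
      using on[of ?A "const c * f"] on[of ?A f]
      by (simp add: lookup_const_mult const_mult sum_distrib_left mult.assoc)
  qed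
qed

section \<open>Permutations of the variables\<close>

lemma lookup_act_array:
  assumes "bij w"
  shows "Poly_Mapping.lookup (act_array w \<beta>) p = Poly_Mapping.lookup \<beta> (inv w p)"
  unfolding act_array_def
  using bij_is_inj[OF bij_imp_bij_inv[OF assms]] by (simp add: map_key.rep_eq)

lemma lookup_act_array_image:
  assumes "bij w"
  shows "Poly_Mapping.lookup (act_array w \<beta>) (w p) = Poly_Mapping.lookup \<beta> p"
  using assms by (simp add: lookup_act_array bij_is_inj)

lemma act_array_comp:
  assumes "bij v" "bij w"
  shows "act_array v (act_array w \<beta>) = act_array (v \<circ> w) \<beta>"
  using assms
  by (intro poly_mapping_eqI) (simp add: lookup_act_array bij_comp o_inv_distrib)

lemma act_array_id [simp]: "act_array id \<beta> = \<beta>"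
  by (intro poly_mapping_eqI) (simp add: lookup_act_array)

lemma act_array_add:
  assumes "bij w"
  shows "act_array w (\<beta> + \<gamma>) = act_array w \<beta> + act_array w \<gamma>"
  using assms by (intro poly_mapping_eqI) (simp add: lookup_act_array lookup_add)

lemma act_array_inv:
  assumes "bij w"
  shows "act_array w (act_array (inv w) \<beta>) = \<beta>" "act_array (inv w) (act_array w \<beta>) = \<beta>"
  using assms by (intro poly_mapping_eqI;
      simp add: lookup_act_array bij_imp_bij_inv inv_inv_eq bij_is_inj bij_is_surj surj_f_inv_f)+

lemma act_array_inject:
  assumes "bij w"
  shows "act_array w \<beta> = act_array w \<gamma> \<longleftrightarrow> \<beta> = \<gamma>"
  using act_array_inv(2)[OF assms] by metis

lemma sum_single_image:
  assumes "bij w"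
  shows "(\<Sum>p\<in>Poly_Mapping.keys \<beta>. Poly_Mapping.single (w p) (Poly_Mapping.lookup \<beta> p))
    = act_array w \<beta>"
proof (rule poly_mapping_eqI)
  fix p'
  obtain p where p: "p' = w p"
    using assms by (metis bij_pointE)
  show "Poly_Mapping.lookup (\<Sum>p\<in>Poly_Mapping.keys \<beta>. Poly_Mapping.single (w p) (Poly_Mapping.lookup \<beta> p)) p'
    = Poly_Mapping.lookup (act_array w \<beta>) p'"
    using bij_is_inj[OF assms]
    by (auto simp: p lookup_act_array_image[OF assms] lookup_sum lookup_single when_def inj_eq in_keys_iff
        cong: if_cong)
qed

text \<open>
  Both the action of the symmetric groups and the operators \<open>T\<close> are substitutions of this
  shape: variables are permuted and rescaled, so monomials go to multiples of monomials.
\<close>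

lemma subst_scaled_permutation_xmon:
  assumes "bij w"
  shows "subst (\<lambda>p. const (c p) * var (w p)) (xmon \<beta>) =
    const (\<Prod>p\<in>Poly_Mapping.keys \<beta>. c p ^ Poly_Mapping.lookup \<beta> p) * xmon (act_array w \<beta>)"
  unfolding sum_single_image[OF assms, symmetric] subst_def
  by (simp add: xmon_def power_mult_distrib prod.distrib const_prod const_power var_power
      xmon_sum[unfolded xmon_def])

lemma linear_act_poly: "scalar_linear (act_poly w)"
  unfolding act_poly_def by (rule linear_subst)

lemma act_poly_xmon: "bij w \<Longrightarrow> act_poly w (xmon \<beta>) = xmon (act_array w \<beta>)"
  using subst_scaled_permutation_xmon[of w "\<lambda>_. 1" \<beta>] by (simp add: act_poly_def)

lemma lookup_act_poly:
  assumes "bij w"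
  shows "Poly_Mapping.lookup (act_poly w f) (act_array w \<mu>) = Poly_Mapping.lookup f \<mu>"
  by (subst linear_expand[OF linear_act_poly])
    (auto simp: lookup_sum lookup_const_mult act_poly_xmon assms lookup_xmon act_array_inject
      in_keys_iff if_distrib cong: if_cong)

section \<open>The operators \<open>T\<close> permute and rescale the variables\<close>

lemma prev_less: "e \<ge> 1 \<Longrightarrow> prev e s k < e"
  by (simp add: prev_def nat_less_iff)

lemma prev_prev: "k < e \<Longrightarrow> prev e (- s) (prev e s k) = k"
  by (simp add: prev_def mod_simps)

lemma finite_positions [simp]: "finite (positions e m)"
  by (simp add: positions_def)

lemma finite_indices: "finite (indices e m)"
  by (auto simp: indices_def intro: finite_PiE)

lemma index_setsD:
  assumes "J \<in> index_sets e m r"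
  shows "i \<in> J \<Longrightarrow> i \<in> indices e m"
    and "i \<in> J \<Longrightarrow> i' \<in> J \<Longrightarrow> k < e \<Longrightarrow> i k = i' k \<Longrightarrow> i = i'"
  using assms by (auto simp: index_sets_def)

lemma finite_index_set: "J \<in> index_sets e m r \<Longrightarrow> finite J"
  using finite_subset[OF _ finite_indices] by (auto simp: index_sets_def)

lemma index_sets_subset:
  assumes "J \<in> index_sets e m r" "J' \<subseteq> J"
  shows "J' \<in> index_sets e m (card J')"
proof -
  have "J' \<subseteq> indices e m"
    using assms by (auto simp only: index_sets_def)
  moreover have "a k \<noteq> b k" if "a \<in> J'" "b \<in> J'" "a \<noteq> b" "k < e" for a b k
    using that assms(2) index_setsD(2)[OF assms(1), of a b k] by blast
  ultimately show ?thesis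
    by (simp only: index_sets_def mem_Collect_eq simp_thms) blast
qed

lemma cellI: "k < e \<Longrightarrow> i \<in> J \<Longrightarrow> (k, i k) \<in> cells e J"
  by (auto simp: cells_def)

lemma cellE:
  assumes "p \<in> cells e J"
  obtains k i where "p = (k, i k)" "k < e" "i \<in> J"
  using assms by (auto simp: cells_def)

lemma cells_subset_positions: "J \<in> index_sets e m r \<Longrightarrow> cells e J \<subseteq> positions e m"
  by (auto simp: cells_def index_sets_def indices_def positions_def PiE_def Pi_def subset_iff)

lemma finite_cells: "J \<in> index_sets e m r \<Longrightarrow> finite (cells e J)"
  by (rule finite_subset[OF cells_subset_positions finite_positions])

text \<open>
  Up to the factors \<open>u\<close>, the operator \<open>T\<close> attached to \<open>J\<close> moves the variable at a cell of an
  index vector in \<open>J\<close> to the cell of the same vector in the neighbouring row. The vector is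
  determined by the cell, because distinct members of \<open>J\<close> differ in every coordinate.
\<close>

definition cell_shift :: "nat \<Rightarrow> int \<Rightarrow> (nat \<Rightarrow> nat) set \<Rightarrow> nat \<times> nat \<Rightarrow> nat \<times> nat" where
  "cell_shift e s J p = (if p \<in> cells e J
     then (prev e s (fst p), (THE i. i \<in> J \<and> i (fst p) = snd p) (prev e s (fst p))) else p)"

lemma cell_shift_cell:
  assumes "J \<in> index_sets e m r" "i \<in> J" "k < e"
  shows "cell_shift e s J (k, i k) = (prev e s k, i (prev e s k))"
proof -
  have "(THE i'. i' \<in> J \<and> i' k = i k) = i"
    using index_setsD(2)[OF assms(1) _ assms(2) assms(3)] assms(2) by (intro the_equality) auto
  then show ?thesis
    using assms by (simp add: cell_shift_def cellI)
qed

lemma cell_shift_other: "p \<notin> cells e J \<Longrightarrow> cell_shift e s J p = p"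
  by (simp add: cell_shift_def)

lemma cell_shift_inverse:
  assumes "e \<ge> 1" "J \<in> index_sets e m r"
  shows "cell_shift e (- s) J (cell_shift e s J p) = p"
proof (cases "p \<in> cells e J")
  case True
  then obtain k i where p: "p = (k, i k)" "k < e" "i \<in> J"
    by (rule cellE)
  then show ?thesis
    using assms by (simp add: cell_shift_cell prev_less prev_prev)
next
  case False
  then show ?thesis
    by (simp add: cell_shift_other)
qed

lemma bij_cell_shift:
  assumes "e \<ge> 1" "J \<in> index_sets e m r"
  shows "bij (cell_shift e s J)"
  by (rule o_bij[of "cell_shift e (- s) J"]; rule ext)
    (use cell_shift_inverse[OF assms, of s] cell_shift_inverse[OF assms, of "- s"] in simp_all)

lemma cell_shift_permutes:
  assumes "e \<ge> 1" "J \<in> index_sets e m r"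
  shows "cell_shift e s J permutes positions e m"
proof -
  have "\<exists>!x. cell_shift e s J x = y" for y
    using bij_cell_shift[OF assms, of s] by (auto simp only: bij_iff)
  moreover have "cell_shift e s J p = p" if "p \<notin> positions e m" for p
    using that cells_subset_positions[OF assms(2)] cell_shift_other by blast
  ultimately show ?thesis
    unfolding permutes_def by blast
qed

lemma cell_shift_empty [simp]: "cell_shift e s {} = id"
  by (auto simp: cell_shift_def cells_def fun_eq_iff)

lemma cells_insert: "cells e (insert i J) = cells e {i} \<union> cells e J"
  by (auto simp: cells_def)

lemma cells_disjoint:
  assumes "J \<in> index_sets e m r" "A \<subseteq> J" "B \<subseteq> J" "A \<inter> B = {}"
  shows "cells e A \<inter> cells e B = {}"
proof -
  have False if "k < e" "i \<in> A" "i' \<in> B" "i k = i' k" for k i i'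
    using index_setsD(2)[OF assms(1), of i i' k] that assms by auto
  then show ?thesis
    by (auto simp: cells_def)
qed

lemma cell_shift_insert:
  assumes "e \<ge> 1" "insert i J \<in> index_sets e m r" "i \<notin> J"
  shows "cell_shift e s (insert i J) = cell_shift e s {i} \<circ> cell_shift e s J"
    and "cell_shift e s (insert i J) = cell_shift e s J \<circ> cell_shift e s {i}"
proof -
  note J = index_sets_subset[OF assms(2) subset_insertI]
    and i = index_sets_subset[OF assms(2) insert_mono[OF empty_subsetI]]
  have disj: "cells e {i} \<inter> cells e J = {}"
    using assms by (intro cells_disjoint[OF assms(2)]) auto
  have "cell_shift e s (insert i J) p = cell_shift e s {i} (cell_shift e s J p) \<and>
        cell_shift e s (insert i J) p = cell_shift e s J (cell_shift e s {i} p)" for p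
  proof (cases "p \<in> cells e (insert i J)")
    case True
    then obtain k i' where p: "p = (k, i' k)" "k < e" "i' \<in> insert i J"
      by (rule cellE)
    have all: "cell_shift e s (insert i J) (k, i' k) = (prev e s k, i' (prev e s k))"
      using cell_shift_cell[OF assms(2) p(3,2)] .
    note k = prev_less[OF assms(1), of s k]
    show ?thesis
    proof (cases "i' = i")
      case True
      have "(k, i k) \<notin> cells e J" "(prev e s k, i (prev e s k)) \<notin> cells e J"
        using disj cellI[of _ e i "{i}"] p(2) k by blast+
      then show ?thesis
        using cell_shift_cell[OF i, of i k s] p(2) all unfolding p(1) True
        by (simp add: cell_shift_other)
    next
      case False
      with p have "i' \<in> J" by simp
      moreover from this have "(k, i' k) \<notin> cells e {i}" "(prev e s k, i' (prev e s k)) \<notin> cells e {i}"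
        using disj cellI[of _ e i' J] p(2) k by blast+
      ultimately show ?thesis
        using cell_shift_cell[OF J, of i' k s] p(2) unfolding p(1) all
        by (simp add: cell_shift_other)
    qed
  next
    case False
    then show ?thesis
      by (auto simp: cells_insert[of e i J] cell_shift_other)
  qed
  note both = this
  show "cell_shift e s (insert i J) = cell_shift e s {i} \<circ> cell_shift e s J"
    by (rule ext) (simp only: both[THEN conjunct1] o_apply)
  show "cell_shift e s (insert i J) = cell_shift e s J \<circ> cell_shift e s {i}"
    by (rule ext) (simp only: both[THEN conjunct2] o_apply)
qed

lemma pairing_singleton:
  assumes "{i} \<in> index_sets e m r"
  shows "(\<Prod>p\<in>Poly_Mapping.keys \<beta>. (if p \<in> cells e {i} then u else 1) ^ Poly_Mapping.lookup \<beta> p)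
    = u ^ pairing e \<beta> {i}"
proof -
  note fin = finite_cells[OF assms]
  have "(\<Prod>p\<in>Poly_Mapping.keys \<beta>. (if p \<in> cells e {i} then u else 1) ^ Poly_Mapping.lookup \<beta> p)
    = (\<Prod>p\<in>Poly_Mapping.keys \<beta> \<inter> cells e {i}. u ^ Poly_Mapping.lookup \<beta> p)"
    by (intro prod.mono_neutral_cong_right) auto
  also have "\<dots> = (\<Prod>p\<in>cells e {i}. u ^ Poly_Mapping.lookup \<beta> p)"
  proof (rule prod.mono_neutral_left[OF fin], blast)
    show "\<forall>p\<in>cells e {i} - Poly_Mapping.keys \<beta> \<inter> cells e {i}. u ^ Poly_Mapping.lookup \<beta> p = 1"
      using not_in_keys_iff_lookup_eq_zero[of _ \<beta>] by (metis Diff_iff IntI power_0)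
  qed
  finally show ?thesis
    by (simp add: pairing_def power_sum)
qed

lemma T_index_xmon:
  assumes "e \<ge> 1" "{i} \<in> index_sets e m r"
  shows "T_index e s u i (xmon \<beta>) =
    const (u ^ pairing e \<beta> {i}) * xmon (act_array (cell_shift e s {i}) \<beta>)"
proof -
  have "(\<lambda>(k, j). if k < e \<and> j = i k then const u * var (prev e s k, i (prev e s k)) else var (k, j))
    = (\<lambda>p. const (if p \<in> cells e {i} then u else 1) * var (cell_shift e s {i} p))"
  proof (rule ext, clarify)
    fix k j
    have "(k, j) \<in> cells e {i} \<longleftrightarrow> k < e \<and> j = i k"
      by (auto simp: cells_def)
    then show "(if k < e \<and> j = i k then const u * var (prev e s k, i (prev e s k)) else var (k, j))
      = const (if (k, j) \<in> cells e {i} then u else 1) * var (cell_shift e s {i} (k, j))"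
      using cell_shift_cell[OF assms(2) singletonI, of k s] cell_shift_other[of "(k, j)" e "{i}" s]
      by simp
  qed
  then show ?thesis
    unfolding T_index_def
    by (simp only: subst_scaled_permutation_xmon[OF bij_cell_shift[OF assms]]
        pairing_singleton[OF assms(2)])
qed

lemma linear_T_index: "scalar_linear (T_index e s u i)"
  unfolding T_index_def by (rule linear_subst)

lemma pairing_act_fixed:
  assumes "bij w" "\<And>p. p \<in> cells e J \<Longrightarrow> w p = p"
  shows "pairing e (act_array w \<beta>) J = pairing e \<beta> J"
  unfolding pairing_def
proof (rule sum.cong[OF refl])
  show "Poly_Mapping.lookup (act_array w \<beta>) p = Poly_Mapping.lookup \<beta> p" if "p \<in> cells e J" for p
    using lookup_act_array_image[OF assms(1), of \<beta> p] assms(2)[OF that] by simp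
qed

text \<open>
  The two operators move disjoint sets of variables, so neither changes the power of \<open>u\<close> that the
  other one produces.
\<close>

lemma T_index_commute:
  assumes "e \<ge> 1" "J \<in> index_sets e m r" "i \<in> J" "i' \<in> J"
  shows "T_index e s u i \<circ> T_index e s u i' = T_index e s u i' \<circ> T_index e s u i"
proof (cases "i = i'")
  case False
  have sets: "{i} \<in> index_sets e m 1" "{i'} \<in> index_sets e m 1" "insert i {i'} \<in> index_sets e m (card {i, i'})"
    using index_sets_subset[OF assms(2), of "{i}"] index_sets_subset[OF assms(2), of "{i'}"]
      index_sets_subset[OF assms(2), of "{i, i'}"] assms by simp_all
  have disj: "cells e {i} \<inter> cells e {i'} = {}"
    using assms False by (intro cells_disjoint[OF assms(2)]) auto
  note bij = bij_cell_shift[OF assms(1) sets(1)] bij_cell_shift[OF assms(1) sets(2)]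
  have pair: "pairing e (act_array (cell_shift e s {i'}) \<mu>) {i} = pairing e \<mu> {i}"
    "pairing e (act_array (cell_shift e s {i}) \<mu>) {i'} = pairing e \<mu> {i'}" for \<mu>
    by (rule pairing_act_fixed[OF bij(2)] pairing_act_fixed[OF bij(1)];
        use disj in \<open>auto intro: cell_shift_other\<close>)+
  have shift: "cell_shift e s {i} \<circ> cell_shift e s {i'} = cell_shift e s {i'} \<circ> cell_shift e s {i}"
    using cell_shift_insert[OF assms(1) sets(3), of s] False by simp
  show ?thesis
    by (intro linear_eqI linear_comp linear_T_index)
      (simp add: linear_scale[OF linear_T_index] T_index_xmon[OF assms(1) sets(1)]
        T_index_xmon[OF assms(1) sets(2)] pair act_array_comp bij shift mult.left_commute)
qed simp

lemma T_set_insert: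
  assumes "e \<ge> 1" "insert i J \<in> index_sets e m r" "i \<notin> J"
  shows "T_set e s u (insert i J) = T_index e s u i \<circ> T_set e s u J"
proof -
  interpret comp_fun_commute_on "insert i J" "\<lambda>i g. T_index e s u i \<circ> g"
  proof
    fix x y
    assume xy: "x \<in> insert i J" "y \<in> insert i J"
    have "T_index e s u y \<circ> (T_index e s u x \<circ> g) = T_index e s u x \<circ> (T_index e s u y \<circ> g)" for g
      by (simp only: comp_assoc[symmetric] T_index_commute[OF assms(1,2) xy])
    then show "(\<circ>) (T_index e s u y) \<circ> (\<circ>) (T_index e s u x) =
        (\<circ>) (T_index e s u x) \<circ> (\<circ>) (T_index e s u y)"
      by - (rule ext, simp only: o_apply)
  qed
  show ?thesis
    unfolding T_set_def using assms(3) finite_index_set[OF assms(2)] by (subst fold_insert) auto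
qed

lemma pairing_insert:
  assumes "insert i J \<in> index_sets e m r" "i \<notin> J"
  shows "pairing e \<beta> (insert i J) = pairing e \<beta> {i} + pairing e \<beta> J"
proof -
  have "cells e {i} \<inter> cells e J = {}"
    using assms by (intro cells_disjoint[OF assms(1)]) auto
  moreover have "finite (cells e {i} \<union> cells e J)"
    using finite_cells[OF assms(1)] cells_insert[of e i J] by simp
  ultimately show ?thesis
    unfolding pairing_def cells_insert[of e i J] by (subst sum.union_disjoint) auto
qed

text \<open>
  The cells of a new index vector are fixed by the moves made so far, so its factor contributes
  the power of \<open>u\<close> read off from the original exponent, and the powers multiply to \<open>u\<close> to the
  pairing with \<open>J\<close>.
\<close>

lemma T_set_props:
  assumes "e \<ge> 1" "J \<in> index_sets e m r"
  shows "scalar_linear (T_set e s u J) \<and> (\<forall>\<beta>. T_set e s u J (xmon \<beta>) =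
    const (u ^ pairing e \<beta> J) * xmon (act_array (cell_shift e s J) \<beta>))"
  using finite_index_set[OF assms(2)] assms(2)
proof (induction J arbitrary: r)
  case empty
  then show ?case
    by (simp add: T_set_def linear_id[unfolded id_def] act_array_id[unfolded id_def] pairing_def cells_def)
next
  case (insert i J)
  have J: "J \<in> index_sets e m (card J)" and i: "{i} \<in> index_sets e m (card {i})"
    using index_sets_subset[OF insert.prems] by blast+
  note bij = bij_cell_shift[OF assms(1) J, of s] bij_cell_shift[OF assms(1) i, of s]
  note IH = insert.IH[OF J, THEN conjunct1] insert.IH[OF J, THEN conjunct2, rule_format]
  have disj: "cells e {i} \<inter> cells e J = {}"
    using insert.hyps(2) by (intro cells_disjoint[OF insert.prems]) auto
  have pair: "pairing e (act_array (cell_shift e s J) \<beta>) {i} = pairing e \<beta> {i}" for \<beta>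
    by (rule pairing_act_fixed[OF bij(1)]) (use disj in \<open>auto intro: cell_shift_other\<close>)
  have "T_set e s u (insert i J) (xmon \<beta>) = const (u ^ pairing e \<beta> (insert i J)) *
      xmon (act_array (cell_shift e s (insert i J)) \<beta>)" for \<beta>
    unfolding T_set_insert[OF assms(1) insert.prems insert.hyps(2)]
      pairing_insert[OF insert.prems insert.hyps(2)]
      cell_shift_insert(1)[OF assms(1) insert.prems insert.hyps(2)]
    by (simp add: IH(2) linear_scale[OF linear_T_index] T_index_xmon[OF assms(1) i] pair
        act_array_comp bij power_add const_mult mult_ac)
  moreover have "scalar_linear (T_set e s u (insert i J))"
    unfolding T_set_insert[OF assms(1) insert.prems insert.hyps(2)]
    by (rule linear_comp[OF linear_T_index IH(1)])
  ultimately show ?case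
    by blast
qed

lemma linear_T_set: "e \<ge> 1 \<Longrightarrow> J \<in> index_sets e m r \<Longrightarrow> scalar_linear (T_set e s u J)"
  and T_set_xmon: "e \<ge> 1 \<Longrightarrow> J \<in> index_sets e m r \<Longrightarrow> T_set e s u J (xmon \<beta>) =
    const (u ^ pairing e \<beta> J) * xmon (act_array (cell_shift e s J) \<beta>)"
  using T_set_props by blast+

lemma act_array_mem:
  assumes "w permutes positions e m" "\<beta> \<in> arrays e m"
  shows "act_array w \<beta> \<in> arrays e m"
proof -
  have "p \<in> positions e m" if "p \<in> Poly_Mapping.keys (act_array w \<beta>)" for p
  proof -
    have "inv w p \<in> Poly_Mapping.keys \<beta>"
      using that by (simp only: in_keys_iff lookup_act_array[OF permutes_bij[OF assms(1)]] simp_thms)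
    then have "inv w p \<in> positions e m"
      using assms(2) by (auto simp only: arrays_def)
    then show ?thesis
      by (simp only: permutes_in_image[OF permutes_inv[OF assms(1)]])
  qed
  then show ?thesis
    unfolding arrays_def by blast
qed

text \<open>
  The exponent \<open>\<beta>\<close> shifted by \<open>J\<close>, characterized through the operator \<open>T\<close>, is the image of \<open>\<beta>\<close>
  under the permutation of positions attached to \<open>J\<close>. The coefficient \<open>q\<close> being nonzero, the
  monomial determines its exponent.
\<close>

lemma shift_array_eq:
  assumes "e \<ge> 1" "J \<in> index_sets e m r" "\<beta> \<in> arrays e m"
  shows "shift_array e m s J \<beta> = act_array (cell_shift e s J) \<beta>"
  unfolding shift_array_def T_set_xmon[OF assms(1,2)]
proof (rule the_equality)
  let ?\<gamma> = "act_array (cell_shift e s J) \<beta>"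
  show "?\<gamma> \<in> arrays e m \<and> const (qq ^ pairing e \<beta> J) * xmon ?\<gamma> = const (qq ^ pairing e \<beta> J) * xmon ?\<gamma>"
    using act_array_mem[OF cell_shift_permutes[OF assms(1,2)] assms(3)] by simp
  have "qq \<noteq> 0"
    by (simp add: qq_def)
  then have "Poly_Mapping.keys (const (qq ^ pairing e \<beta> J) * xmon \<gamma>) = {\<gamma>}" for \<gamma>
    by (simp add: const_mult_xmon)
  then show "\<gamma> = ?\<gamma>" if "\<gamma> \<in> arrays e m \<and>
      const (qq ^ pairing e \<beta> J) * xmon ?\<gamma> = const (qq ^ pairing e \<beta> J) * xmon \<gamma>" for \<gamma>
    using that by (metis singleton_inject)
qed

section \<open>The row group\<close>

lemma row_groupD:
  assumes "w \<in> row_group e m"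
  shows "w permutes positions e m" "bij w" "permutation w" "fst (w p) = fst p"
proof -
  show perm: "w permutes positions e m" and "fst (w p) = fst p"
    using assms by (simp_all only: row_group_def mem_Collect_eq)
  show "bij w"
    by (rule permutes_bij[OF perm])
  show "permutation w"
    unfolding permutation_permutes using perm finite_positions by blast
qed

lemma row_groupI:
  "w permutes positions e m \<Longrightarrow> (\<And>p. fst (w p) = fst p) \<Longrightarrow> w \<in> row_group e m"
  by (simp add: row_group_def)

lemma row_group_id: "id \<in> row_group e m"
  by (simp add: row_group_def permutes_id)

lemma row_group_comp:
  assumes "v \<in> row_group e m" "w \<in> row_group e m"
  shows "v \<circ> w \<in> row_group e m"
  by (rule row_groupI[OF permutes_compose[OF row_groupD(1)[OF assms(2)] row_groupD(1)[OF assms(1)]]])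
    (simp only: o_apply row_groupD(4)[OF assms(1)] row_groupD(4)[OF assms(2)])

lemma row_group_inv:
  assumes "w \<in> row_group e m"
  shows "inv w \<in> row_group e m"
proof (rule row_groupI)
  show "inv w permutes positions e m"
    by (rule permutes_inv[OF row_groupD(1)[OF assms]])
  fix p
  have "fst (w (inv w p)) = fst (inv w p)"
    by (rule row_groupD(4)[OF assms])
  then show "fst (inv w p) = fst p"
    using permutes_inverses(1)[OF row_groupD(1)[OF assms], of p] by simp
qed

lemma finite_row_group: "finite (row_group e m)"
  by (rule finite_subset[OF _ finite_permutations[OF finite_positions[of e m]]])
    (auto simp: row_group_def)

lemma comp_inv_row_group:
  assumes "w \<in> row_group e m"
  shows "v \<circ> w \<circ> inv w = v" "v \<circ> inv w \<circ> w = v"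
  using permutes_inv_o[OF row_groupD(1)[OF assms]] by (simp_all add: comp_assoc)

lemma sum_row_group_comp:
  assumes "u \<in> row_group e m"
  shows "(\<Sum>w\<in>row_group e m. f (w \<circ> u)) = (\<Sum>w\<in>row_group e m. f w)"
  by (rule sum.reindex_bij_witness[of _ "\<lambda>w. w \<circ> inv u" "\<lambda>w. w \<circ> u"])
    (auto simp: comp_inv_row_group[OF assms] row_group_comp row_group_inv assms)

lemma sign_row_group_comp:
  assumes "v \<in> row_group e m" "w \<in> row_group e m"
  shows "sign (v \<circ> w) = sign v * sign w"
  by (rule sign_compose[OF row_groupD(3)[OF assms(1)] row_groupD(3)[OF assms(2)]])

lemma act_row_group_comp:
  assumes "v \<in> row_group e m" "w \<in> row_group e m"
  shows "act_array (v \<circ> w) \<beta> = act_array v (act_array w \<beta>)"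
  by (rule act_array_comp[symmetric]) (rule row_groupD(2)[OF assms(1)] row_groupD(2)[OF assms(2)])+

lemma act_row_group_mem: "w \<in> row_group e m \<Longrightarrow> \<beta> \<in> arrays e m \<Longrightarrow> act_array w \<beta> \<in> arrays e m"
  by (rule act_array_mem[OF row_groupD(1)])

lemma arrays_add: "\<beta> \<in> arrays e m \<Longrightarrow> \<gamma> \<in> arrays e m \<Longrightarrow> \<beta> + \<gamma> \<in> arrays e m"
  using keys_add[of \<beta> \<gamma>] by (auto simp: arrays_def)

lemma lookup_delta:
  "Poly_Mapping.lookup (delta e m) (k, j) = (if (k, j) \<in> positions e m then m k - j else 0)"
proof -
  have "Poly_Mapping.lookup (delta e m) (k, j)
    = (\<Sum>p\<in>positions e m. if p = (k, j) then m k - j else 0)"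
    unfolding delta_def lookup_sum
    by (rule sum.cong[OF refl]) (auto simp: lookup_single when_def split: if_splits)
  then show ?thesis
    by (simp add: sum.delta)
qed

lemma delta_mem: "delta e m \<in> arrays e m"
proof -
  have "p \<in> positions e m" if "Poly_Mapping.lookup (delta e m) p \<noteq> 0" for p
    using that by (cases p) (simp add: lookup_delta split: if_splits)
  then show ?thesis
    by (auto simp: arrays_def in_keys_iff)
qed

lemma antisymm_eq:
  "antisymm e m \<gamma> = (\<Sum>w\<in>row_group e m. of_int (sign w) * xmon (act_array w \<gamma>))"
  unfolding antisymm_def
  by (rule sum.cong[OF refl]) (simp add: act_poly_xmon row_groupD(2))

lemma antisymm_act:
  assumes "u \<in> row_group e m"
  shows "antisymm e m (act_array u \<gamma>) = of_int (sign u) * antisymm e m \<gamma>"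
proof -
  have "antisymm e m (act_array u \<gamma>)
    = (\<Sum>w\<in>row_group e m. of_int (sign u) * (of_int (sign (w \<circ> u)) * xmon (act_array (w \<circ> u) \<gamma>)))"
    unfolding antisymm_eq
  proof (rule sum.cong[OF refl])
    fix w
    assume w: "w \<in> row_group e m"
    have eq: "sign u * (sign w * sign u) = sign w"
      by (metis mult.left_commute mult.right_neutral sign_idempotent)
    have sign: "of_int (sign u) * (of_int (sign w * sign u) * X) = (of_int (sign w) * X :: xpoly)" for X
      by (simp only: mult.assoc[of "of_int (sign u)", symmetric] of_int_mult[symmetric] eq)
    show "of_int (sign w) * xmon (act_array w (act_array u \<gamma>))
      = of_int (sign u) * (of_int (sign (w \<circ> u)) * xmon (act_array (w \<circ> u) \<gamma>))"
      by (simp only: sign_row_group_comp[OF w assms] act_row_group_comp[OF w assms] sign)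
  qed
  also have "\<dots> = of_int (sign u) * antisymm e m \<gamma>"
    unfolding sum_distrib_left[symmetric] antisymm_eq
    by (simp only: sum_row_group_comp[OF assms, of "\<lambda>w. of_int (sign w) * xmon (act_array w \<gamma>)"])
  finally show ?thesis .
qed

lemma row_perms_act:
  assumes "w \<in> row_group e m" "\<beta> \<in> row_perms e m \<alpha>"
  shows "act_array w \<beta> \<in> row_perms e m \<alpha>"
proof -
  obtain v where v: "v \<in> row_group e m" "\<beta> = act_array v \<alpha>"
    using assms(2) by (auto simp: row_perms_def)
  have "act_array w \<beta> = act_array (w \<circ> v) \<alpha>"
    unfolding v(2) by (rule act_row_group_comp[OF assms(1) v(1), symmetric])
  then show ?thesis
    unfolding row_perms_def using row_group_comp[OF assms(1) v(1)] by blast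
qed

lemma finite_row_perms: "finite (row_perms e m \<alpha>)"
  by (simp add: row_perms_def finite_row_group)

lemma row_perms_self: "\<alpha> \<in> row_perms e m \<alpha>"
  unfolding row_perms_def by (rule image_eqI[OF _ row_group_id]) simp

lemma row_perms_mem: "\<alpha> \<in> arrays e m \<Longrightarrow> \<beta> \<in> row_perms e m \<alpha> \<Longrightarrow> \<beta> \<in> arrays e m"
  by (auto simp: row_perms_def act_row_group_mem)

lemma sum_row_perms_act:
  assumes w: "w \<in> row_group e m"
  shows "(\<Sum>\<beta>\<in>row_perms e m \<alpha>. f (act_array w \<beta>)) = (\<Sum>\<beta>\<in>row_perms e m \<alpha>. f \<beta>)"
  by (rule sum.reindex_bij_witness[of _ "act_array (inv w)" "act_array w"])
    (simp_all add: act_array_inv[OF row_groupD(2)[OF w]] row_perms_act[OF w]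
      row_perms_act[OF row_group_inv[OF w]])

section \<open>Row permutations of index vectors\<close>

text \<open>
  An index vector selects one position in each row, and the row group permutes these selections.
  Outside the rows \<open>k < e\<close> the value is left undefined, because index vectors are extensional
  functions.
\<close>

definition act_index :: "nat \<Rightarrow> (nat \<times> nat \<Rightarrow> nat \<times> nat) \<Rightarrow> (nat \<Rightarrow> nat) \<Rightarrow> nat \<Rightarrow> nat" where
  "act_index e w i = (\<lambda>k\<in>{..<e}. snd (w (k, i k)))"

lemma act_index_cell:
  assumes "w \<in> row_group e m" "k < e"
  shows "(k, act_index e w i k) = w (k, i k)"
  using row_groupD(4)[OF assms(1), of "(k, i k)"] assms(2)
  by (simp add: act_index_def prod_eq_iff)

lemma act_index_mem:
  assumes "w \<in> row_group e m" "i \<in> indices e m"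
  shows "act_index e w i \<in> indices e m"
  unfolding indices_def
proof (rule PiE_I)
  fix k
  assume "k \<in> {..<e}"
  then have k: "k < e" by simp
  then have "(k, i k) \<in> positions e m"
    using PiE_mem[OF assms(2)[unfolded indices_def], of k] by (simp add: positions_def)
  then have "(k, act_index e w i k) \<in> positions e m"
    unfolding act_index_cell[OF assms(1) k] using permutes_in_image[OF row_groupD(1)[OF assms(1)]] by simp
  then show "act_index e w i k \<in> {1..m k}"
    by (simp add: positions_def)
qed (simp add: act_index_def)

lemma act_index_inverse:
  assumes "w \<in> row_group e m" "v \<in> row_group e m" "\<And>p. v (w p) = p" "i \<in> indices e m"
  shows "act_index e v (act_index e w i) = i"
proof
  fix k
  show "act_index e v (act_index e w i) k = i k"
  proof (cases "k < e")
    case True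
    have "(k, act_index e v (act_index e w i) k) = (k, i k)"
      using act_index_cell[OF assms(2) True, of "act_index e w i"] act_index_cell[OF assms(1) True, of i]
        assms(3) by simp
    then show ?thesis by simp
  next
    case False
    then show ?thesis
      using assms(4) by (auto simp: act_index_def indices_def PiE_def extensional_def)
  qed
qed

lemma cells_act_index:
  assumes "w \<in> row_group e m"
  shows "cells e (act_index e w ` J) = w ` cells e J"
proof (rule set_eqI)
  fix p
  have "p \<in> cells e (act_index e w ` J) \<longleftrightarrow> (\<exists>k<e. \<exists>i\<in>J. p = (k, act_index e w i k))"
    by (auto simp: cells_def)
  also have "\<dots> \<longleftrightarrow> (\<exists>k<e. \<exists>i\<in>J. p = w (k, i k))"
    by (intro ex_cong1 conj_cong bex_cong refl) (simp only: act_index_cell[OF assms])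
  also have "\<dots> \<longleftrightarrow> p \<in> w ` cells e J"
    by (auto simp: cells_def)
  finally show "p \<in> cells e (act_index e w ` J) \<longleftrightarrow> p \<in> w ` cells e J" .
qed

lemma act_index_inj_on:
  assumes "w \<in> row_group e m"
  shows "inj_on (act_index e w) (indices e m)"
  by (rule inj_on_inverseI[of _ "act_index e (inv w)"])
    (rule act_index_inverse[OF assms row_group_inv[OF assms] permutes_inverses(2)[OF row_groupD(1)[OF assms]]])

lemma index_sets_act:
  assumes w: "w \<in> row_group e m" and J: "J \<in> index_sets e m r"
  shows "act_index e w ` J \<in> index_sets e m r"
proof -
  have sub: "J \<subseteq> indices e m" and card: "card J = r"
    using J by (auto simp: index_sets_def)
  have "act_index e w i k \<noteq> act_index e w i' k"
    if "i \<in> J" "i' \<in> J" "act_index e w i \<noteq> act_index e w i'" "k < e" for i i' k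
  proof
    assume "act_index e w i k = act_index e w i' k"
    then have "w (k, i k) = w (k, i' k)"
      using act_index_cell[OF w that(4), of i] act_index_cell[OF w that(4), of i'] by simp
    then have "i k = i' k"
      using bij_is_inj[OF row_groupD(2)[OF w]] by (simp add: inj_eq)
    then show False
      using index_setsD(2)[OF J that(1,2,4)] that(3) by simp
  qed
  moreover have "card (act_index e w ` J) = r"
    using card_image[OF inj_on_subset[OF act_index_inj_on[OF w] sub]] card by simp
  ultimately show ?thesis
    using sub act_index_mem[OF w] by (auto simp: index_sets_def)
qed

lemma sum_index_sets_act:
  assumes w: "w \<in> row_group e m"
  shows "(\<Sum>J\<in>index_sets e m r. f (act_index e w ` J)) = (\<Sum>J\<in>index_sets e m r. f J)"
proof (rule sum.reindex_bij_witness[of _ "(`) (act_index e (inv w))" "(`) (act_index e w)"])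
  fix J
  assume J: "J \<in> index_sets e m r"
  note inverse = permutes_inverses[OF row_groupD(1)[OF w]]
  have "\<forall>i\<in>J. act_index e (inv w) (act_index e w i) = i" "\<forall>i\<in>J. act_index e w (act_index e (inv w) i) = i"
    using index_setsD(1)[OF J] act_index_inverse[OF w row_group_inv[OF w] inverse(2)]
      act_index_inverse[OF row_group_inv[OF w] w inverse(1)] by blast+
  then show "act_index e (inv w) ` (act_index e w ` J) = J" "act_index e w ` (act_index e (inv w) ` J) = J"
    by (simp_all add: image_image)
qed (simp_all add: index_sets_act w row_group_inv)

text \<open>
  Moving along the cells of \<open>w(J)\<close> is the conjugate by \<open>w\<close> of moving along the cells of \<open>J\<close>: both
  send the cell of \<open>w(i)\<close> in row \<open>k\<close> to the cell of \<open>w(i)\<close> in the neighbouring row.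
\<close>

lemma cell_shift_act:
  assumes "e \<ge> 1" and w: "w \<in> row_group e m" and J: "J \<in> index_sets e m r"
  shows "cell_shift e s (act_index e w ` J) \<circ> w = w \<circ> cell_shift e s J"
proof
  fix p
  show "(cell_shift e s (act_index e w ` J) \<circ> w) p = (w \<circ> cell_shift e s J) p"
  proof (cases "p \<in> cells e J")
    case True
    then obtain k i where p: "p = (k, i k)" "k < e" "i \<in> J"
      by (rule cellE)
    show ?thesis
      using cell_shift_cell[OF index_sets_act[OF w J] imageI[OF p(3)] p(2), of s]
        cell_shift_cell[OF J p(3,2), of s] act_index_cell[OF w p(2), of i]
        act_index_cell[OF w prev_less[OF assms(1)], of s k i] p(1) by simp
  next
    case False
    then have "w p \<notin> cells e (act_index e w ` J)"
      unfolding cells_act_index[OF w]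
      using bij_is_inj[OF row_groupD(2)[OF w]] by (simp add: inj_image_mem_iff)
    then show ?thesis
      using False by (simp add: cell_shift_other)
  qed
qed

lemma pairing_act:
  assumes "w \<in> row_group e m"
  shows "pairing e (act_array w \<beta>) (act_index e w ` J) = pairing e \<beta> J"
  unfolding pairing_def cells_act_index[OF assms]
  by (subst sum.reindex)
    (simp_all add: lookup_act_array_image row_groupD(2)[OF assms]
      inj_on_subset[OF bij_is_inj[OF row_groupD(2)[OF assms]]])

lemma act_cell_shift:
  assumes "e \<ge> 1" and w: "w \<in> row_group e m" and J: "J \<in> index_sets e m r"
  shows "act_array (cell_shift e s (act_index e w ` J)) (act_array w \<gamma>)
    = act_array w (act_array (cell_shift e s J) \<gamma>)"
  by (simp only: act_array_comp bij_cell_shift[OF assms(1) index_sets_act[OF w J]] row_groupD(2)[OF w]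
      bij_cell_shift[OF assms(1) J] cell_shift_act[OF assms])

section \<open>The numerator of the operators\<close>

text \<open>
  With the denominator cleared the operator acts within the polynomial ring.
\<close>

definition D_numerator :: "nat \<Rightarrow> (nat \<Rightarrow> nat) \<Rightarrow> int \<Rightarrow> nat \<Rightarrow> xpoly \<Rightarrow> xpoly" where
  "D_numerator e m s r f = (\<Sum>w\<in>row_group e m. of_int (sign w) *
     (\<Sum>J\<in>index_sets e m r. xmon (shift_array e m s J (act_array w (delta e m))) *
        const (tt ^ pairing e (act_array w (delta e m)) J) * T_set e s qq J f))"

lemma to_fract_of_int: "to_fract (of_int k) = (of_int k :: xpoly fract)"
proof -
  have "to_fract (of_nat n) = (of_nat n :: xpoly fract)" for n
    by (induction n) simp_all
  then show ?thesis
    by (cases k) (simp_all del: of_nat_Suc)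
qed

lemma D_op_eq:
  "D_op e m s r f = to_fract (D_numerator e m s r f) / to_fract (antisymm e m (delta e m))"
  unfolding D_op_def D_numerator_def divide_inverse to_fract_sum to_fract_mult to_fract_of_int
  by (rule mult.commute)

text \<open>
  In the summand for \<open>w\<close>, the set \<open>J\<close> may be replaced by \<open>w(J)\<close> and the monomial \<open>x^\<beta>\<close> of the orbit
  by \<open>x^{w(\<beta>)}\<close>. By equivariance both pairings then no longer depend on \<open>w\<close>, and the two
  monomials combine to the image under \<open>w\<close> of the monomial with exponent \<open>\<beta> + \<delta>\<close> shifted by \<open>J\<close>.
  What remains of the sum over \<open>w\<close> is an alternant.
\<close>

lemma D_numerator_orbit:
  assumes "e \<ge> 1" and \<alpha>: "\<alpha> \<in> arrays e m"
  shows "D_numerator e m s r (\<Sum>\<beta>\<in>row_perms e m \<alpha>. xmon \<beta>) =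
    (\<Sum>\<beta>\<in>row_perms e m \<alpha>. \<Sum>J\<in>index_sets e m r.
      const (tt ^ pairing e (delta e m) J * qq ^ pairing e \<beta> J) *
      antisymm e m (act_array (cell_shift e s J) (\<beta> + delta e m)))"
proof -
  let ?\<delta> = "delta e m" and ?R = "row_perms e m \<alpha>" and ?I = "index_sets e m r"
  let ?c = "\<lambda>\<beta> J. const (tt ^ pairing e ?\<delta> J * qq ^ pairing e \<beta> J)"
  define B where "B w J = xmon (shift_array e m s J (act_array w ?\<delta>)) *
    const (tt ^ pairing e (act_array w ?\<delta>) J) * T_set e s qq J (\<Sum>\<beta>\<in>?R. xmon \<beta>)" for w J
  have B: "B w (act_index e w ` J) = (\<Sum>\<beta>\<in>?R. ?c \<beta> J *
      xmon (act_array w (act_array (cell_shift e s J) (\<beta> + ?\<delta>))))"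
    if w: "w \<in> row_group e m" and J: "J \<in> ?I" for w J
  proof -
    note wJ = index_sets_act[OF w J] and lin = linear_T_set[OF assms(1) index_sets_act[OF w J], of s qq]
    have "T_set e s qq (act_index e w ` J) (\<Sum>\<beta>\<in>?R. xmon \<beta>)
      = T_set e s qq (act_index e w ` J) (\<Sum>\<beta>\<in>?R. xmon (act_array w \<beta>))"
      by (simp only: sum_row_perms_act[OF w])
    also have "\<dots> = (\<Sum>\<beta>\<in>?R. const (qq ^ pairing e \<beta> J) *
        xmon (act_array w (act_array (cell_shift e s J) \<beta>)))"
      by (simp only: linear_sum[OF lin] T_set_xmon[OF assms(1) wJ] pairing_act[OF w]
          act_cell_shift[OF assms(1) w J])
    finally have T: "T_set e s qq (act_index e w ` J) (\<Sum>\<beta>\<in>?R. xmon \<beta>) = (\<Sum>\<beta>\<in>?R.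
        const (qq ^ pairing e \<beta> J) * xmon (act_array w (act_array (cell_shift e s J) \<beta>)))" .
    have shift: "shift_array e m s (act_index e w ` J) (act_array w ?\<delta>)
      = act_array w (act_array (cell_shift e s J) ?\<delta>)"
      by (simp only: shift_array_eq[OF assms(1) wJ act_row_group_mem[OF w delta_mem]]
          act_cell_shift[OF assms(1) w J])
    show ?thesis
      unfolding B_def T shift pairing_act[OF w] sum_distrib_left
      by (rule sum.cong[OF refl])
        (simp only: act_array_add[OF bij_cell_shift[OF assms(1) J]] act_array_add[OF row_groupD(2)[OF w]]
          xmon_add const_mult mult_ac)
  qed
  have "D_numerator e m s r (\<Sum>\<beta>\<in>?R. xmon \<beta>)
    = (\<Sum>w\<in>row_group e m. of_int (sign w) * (\<Sum>J\<in>?I. B w (act_index e w ` J)))"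
    unfolding D_numerator_def B_def[symmetric]
    by (rule sum.cong[OF refl]) (simp only: sum_index_sets_act)
  also have "\<dots> = (\<Sum>w\<in>row_group e m. \<Sum>J\<in>?I. \<Sum>\<beta>\<in>?R. ?c \<beta> J *
      (of_int (sign w) * xmon (act_array w (act_array (cell_shift e s J) (\<beta> + ?\<delta>)))))"
    unfolding sum_distrib_left
    by (intro sum.cong refl) (simp only: B sum_distrib_left mult_ac)
  also have "\<dots> = (\<Sum>\<beta>\<in>?R. \<Sum>J\<in>?I. \<Sum>w\<in>row_group e m. ?c \<beta> J *
      (of_int (sign w) * xmon (act_array w (act_array (cell_shift e s J) (\<beta> + ?\<delta>)))))"
    by (subst sum.swap, subst sum.swap[of _ ?R], rule sum.cong[OF refl], subst sum.swap) (rule refl)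
  also have "\<dots> = (\<Sum>\<beta>\<in>?R. \<Sum>J\<in>?I. ?c \<beta> J *
      antisymm e m (act_array (cell_shift e s J) (\<beta> + ?\<delta>)))"
    by (simp only: sum_distrib_left[symmetric] antisymm_eq)
  finally show ?thesis .
qed

lemma index_sets_zero: "index_sets e m 0 = {{}}"
proof -
  have "J = {}" if "J \<in> index_sets e m 0" for J
    using that finite_index_set[OF that] by (auto simp: index_sets_def)
  then show ?thesis
    by (auto simp: index_sets_def)
qed

text \<open>
  For \<open>r = 0\<close> the operator is the identity, and the formula for its numerator expresses the
  product of the Vandermonde determinant with an orbit sum through alternants.
\<close>

lemma antisymm_delta_times_orbit:
  assumes "e \<ge> 1" and \<alpha>: "\<alpha> \<in> arrays e m"
  shows "antisymm e m (delta e m) * (\<Sum>\<beta>\<in>row_perms e m \<alpha>. xmon \<beta>) =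
    (\<Sum>\<beta>\<in>row_perms e m \<alpha>. antisymm e m (\<beta> + delta e m))"
proof -
  have mem: "{} \<in> index_sets e m 0"
    by (simp add: index_sets_zero)
  have shift: "shift_array e m 1 {} (act_array w (delta e m)) = act_array w (delta e m)"
    if "w \<in> row_group e m" for w
    using shift_array_eq[OF assms(1) mem act_row_group_mem[OF that delta_mem], of 1] by simp
  have "D_numerator e m 1 0 (\<Sum>\<beta>\<in>row_perms e m \<alpha>. xmon \<beta>)
    = (\<Sum>w\<in>row_group e m. of_int (sign w) * xmon (act_array w (delta e m)) *
        (\<Sum>\<beta>\<in>row_perms e m \<alpha>. xmon \<beta>))"
    unfolding D_numerator_def
    by (rule sum.cong[OF refl])
      (simp add: index_sets_zero shift pairing_def cells_def T_set_def mult.assoc)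
  also have "\<dots> = antisymm e m (delta e m) * (\<Sum>\<beta>\<in>row_perms e m \<alpha>. xmon \<beta>)"
    unfolding antisymm_eq sum_distrib_right ..
  finally show ?thesis
    unfolding D_numerator_orbit[OF assms, symmetric]
    by (simp add: D_numerator_orbit[OF assms] index_sets_zero pairing_def cells_def)
qed

section \<open>Monomial symmetric polynomials as orbit sums\<close>

lemma lookup_row:
  "Poly_Mapping.lookup (row m k \<alpha>) p =
    (if p \<in> {k} \<times> {1..m k} then Poly_Mapping.lookup \<alpha> p else 0)"
proof (cases p)
  case (Pair k' j')
  have "Poly_Mapping.lookup (row m k \<alpha>) p
    = (\<Sum>j=1..m k. if j' = j then (if k' = k then Poly_Mapping.lookup \<alpha> (k, j) else 0) else 0)"
    unfolding row_def lookup_sum Pair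
    by (rule sum.cong[OF refl]) (auto simp: lookup_single when_def)
  also have "\<dots> = (if j' \<in> {1..m k} then if k' = k then Poly_Mapping.lookup \<alpha> (k, j') else 0 else 0)"
    by (rule sum.delta') simp
  finally show ?thesis
    by (simp add: Pair)
qed

lemma sum_row_supported:
  fixes g :: "nat \<Rightarrow> array"
  assumes g: "\<And>k. k < e \<Longrightarrow> Poly_Mapping.keys (g k) \<subseteq> {k} \<times> {1..m k}"
  shows "Poly_Mapping.lookup (\<Sum>k<e. g k) (k, j)
    = (if k < e then Poly_Mapping.lookup (g k) (k, j) else 0)"
proof -
  have "Poly_Mapping.lookup (\<Sum>k<e. g k) (k, j)
    = (\<Sum>k'<e. if k' = k then Poly_Mapping.lookup (g k) (k, j) else 0)"
    unfolding lookup_sum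
  proof (rule sum.cong[OF refl])
    fix k'
    assume "k' \<in> {..<e}"
    then have "(k, j) \<notin> Poly_Mapping.keys (g k')" if "k' \<noteq> k"
      using g[of k'] that by auto
    then show "Poly_Mapping.lookup (g k') (k, j) = (if k' = k then Poly_Mapping.lookup (g k) (k, j) else 0)"
      by (simp add: not_in_keys_iff_lookup_eq_zero)
  qed
  then show ?thesis
    by (simp only: sum.delta[OF finite_lessThan] lessThan_iff)
qed

lemma keys_row: "Poly_Mapping.keys (row m k \<alpha>) \<subseteq> {k} \<times> {1..m k}"
proof
  fix p
  assume "p \<in> Poly_Mapping.keys (row m k \<alpha>)"
  then show "p \<in> {k} \<times> {1..m k}"
    by (simp only: in_keys_iff lookup_row split: if_splits)
qed

lemma lookup_outside: "\<beta> \<in> arrays e m \<Longrightarrow> p \<notin> positions e m \<Longrightarrow> Poly_Mapping.lookup \<beta> p = 0"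
  by (auto simp: arrays_def not_in_keys_iff_lookup_eq_zero[symmetric])

lemma mem_positions: "(k, j) \<in> positions e m \<longleftrightarrow> k < e \<and> j \<in> {1..m k}"
  by (simp add: positions_def)

lemma sum_rows:
  assumes "\<beta> \<in> arrays e m"
  shows "(\<Sum>k<e. row m k \<beta>) = \<beta>"
proof (rule poly_mapping_eqI)
  fix p :: "nat \<times> nat"
  obtain k j where p: "p = (k, j)"
    by (cases p)
  show "Poly_Mapping.lookup (\<Sum>k<e. row m k \<beta>) p = Poly_Mapping.lookup \<beta> p"
    using lookup_outside[OF assms, of p]
    unfolding p sum_row_supported[OF keys_row] lookup_row mem_positions by auto
qed

definition row_orbit :: "(nat \<Rightarrow> nat) \<Rightarrow> nat \<Rightarrow> array \<Rightarrow> array set" where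
  "row_orbit m k \<alpha> = (\<lambda>w. act_array w (row m k \<alpha>)) ` {w. w permutes {k} \<times> {1..m k}}"

lemma keys_row_orbit:
  assumes "\<gamma> \<in> row_orbit m k \<alpha>"
  shows "Poly_Mapping.keys \<gamma> \<subseteq> {k} \<times> {1..m k}"
proof
  fix p
  assume p: "p \<in> Poly_Mapping.keys \<gamma>"
  obtain w where w: "w permutes {k} \<times> {1..m k}" and \<gamma>: "\<gamma> = act_array w (row m k \<alpha>)"
    using assms by (auto simp: row_orbit_def)
  have "inv w p \<in> Poly_Mapping.keys (row m k \<alpha>)"
    using p by (simp only: in_keys_iff \<gamma> lookup_act_array[OF permutes_bij[OF w]] simp_thms)
  then have "inv w p \<in> {k} \<times> {1..m k}"
    using keys_row by blast
  then show "p \<in> {k} \<times> {1..m k}"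
    by (simp only: permutes_in_image[OF permutes_inv[OF w]])
qed

text \<open>
  The restriction of a row permutation to row \<open>k\<close>, extended by the identity, permutes that row.
\<close>

lemma row_mem_row_orbit:
  assumes \<beta>: "\<beta> \<in> row_perms e m \<alpha>" and k: "k < e"
  shows "row m k \<beta> \<in> row_orbit m k \<alpha>"
proof -
  obtain w where w: "w \<in> row_group e m" and \<beta>: "\<beta> = act_array w \<alpha>"
    using \<beta> by (auto simp: row_perms_def)
  let ?V = "{k} \<times> {1..m k}"
  define restr :: "(nat \<times> nat \<Rightarrow> nat \<times> nat) \<Rightarrow> nat \<times> nat \<Rightarrow> nat \<times> nat"
    where "restr v p = (if fst p = k then v p else p)" for v p
  have inverse: "restr (inv v) (restr v p) = p" if "v \<in> row_group e m" for v p
    using row_groupD(4)[OF that, of p] permutes_inverses(2)[OF row_groupD(1)[OF that], of p]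
    by (simp add: restr_def)
  have inv: "restr (inv w) (restr w p) = p" "restr w (restr (inv w) p) = p" for p
    using inverse[OF w] inverse[OF row_group_inv[OF w]]
    by (simp_all add: inv_inv_eq[OF row_groupD(2)[OF w]])
  have bij: "bij (restr w)"
    by (rule o_bij[of "restr (inv w)"]; rule ext) (simp_all add: inv)
  have V: "w p \<in> ?V \<longleftrightarrow> p \<in> ?V" if "fst p = k" for p
    using permutes_in_image[OF row_groupD(1)[OF w], of p] row_groupD(4)[OF w, of p] that k
    by (cases p; cases "w p") (simp add: mem_positions)
  have outside: "restr w p = p" if "p \<notin> ?V" for p
  proof (cases "fst p = k")
    case True
    then have "p \<notin> positions e m"
      using that k by (cases p) (simp add: mem_positions)
    then show ?thesis
      using permutes_not_in[OF row_groupD(1)[OF w]] by (simp add: restr_def)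
  qed (simp add: restr_def)
  have "\<exists>!x. restr w x = y" for y
    using bij by (auto simp only: bij_iff)
  then have perm: "restr w permutes ?V"
    unfolding permutes_def using outside by blast
  have "row m k \<beta> = act_array (restr w) (row m k \<alpha>)"
  proof (rule poly_mapping_eqI)
    fix p'
    obtain p where p: "p' = restr w p"
      using bij by (metis bij_pointE)
    have "Poly_Mapping.lookup (row m k \<beta>) (restr w p) = Poly_Mapping.lookup (row m k \<alpha>) p"
    proof (cases "fst p = k")
      case True
      then show ?thesis
        using V[OF True] lookup_act_array_image[OF row_groupD(2)[OF w], of \<alpha> p]
        by (simp add: restr_def lookup_row \<beta>)
    next
      case False
      then show ?thesis
        by (cases p) (simp add: restr_def lookup_row)
    qed
    then show "Poly_Mapping.lookup (row m k \<beta>) p' = Poly_Mapping.lookup (act_array (restr w) (row m k \<alpha>)) p'"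
      by (simp only: p lookup_act_array_image[OF bij])
  qed
  then show ?thesis
    unfolding row_orbit_def using perm by blast
qed

text \<open>
  Conversely, permutations chosen independently for all rows glue to an element of the row group.
\<close>

lemma sum_row_orbits_mem:
  assumes \<alpha>: "\<alpha> \<in> arrays e m" and g: "\<And>k. k < e \<Longrightarrow> g k \<in> row_orbit m k \<alpha>"
  shows "(\<Sum>k<e. g k) \<in> row_perms e m \<alpha>"
proof -
  have "\<forall>k\<in>{..<e}. \<exists>w. w permutes {k} \<times> {1..m k} \<and> g k = act_array w (row m k \<alpha>)"
    using g by (auto simp: row_orbit_def)
  then obtain v where v: "\<forall>k\<in>{..<e}. v k permutes {k} \<times> {1..m k} \<and> g k = act_array (v k) (row m k \<alpha>)"
    by (rule bchoice[THEN exE])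
  have perm: "v k permutes {k} \<times> {1..m k}" and gk: "g k = act_array (v k) (row m k \<alpha>)" if "k < e" for k
    using v that by simp_all
  define glue :: "(nat \<Rightarrow> nat \<times> nat \<Rightarrow> nat \<times> nat) \<Rightarrow> nat \<times> nat \<Rightarrow> nat \<times> nat"
    where "glue u p = (if fst p < e then u (fst p) p else p)" for u p
  have row: "fst (u k p) = k" if "u k permutes {k} \<times> {1..m k}" "fst p = k" for u k p
  proof (cases "p \<in> {k} \<times> {1..m k}")
    case True
    then have "u k p \<in> {k} \<times> {1..m k}"
      by (simp only: permutes_in_image[OF that(1)])
    then show ?thesis by auto
  next
    case False
    then show ?thesis
      using permutes_not_in[OF that(1) False] that(2) by simp
  qed
  note perm' = permutes_inv[OF perm]
  have fst: "fst (glue v p) = fst p" "fst (glue (\<lambda>k. inv (v k)) p) = fst p" for p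
    using row[of v "fst p", OF perm] row[of "\<lambda>k. inv (v k)" "fst p", OF perm'] by (auto simp: glue_def)
  have inv: "glue (\<lambda>k. inv (v k)) (glue v p) = p" "glue v (glue (\<lambda>k. inv (v k)) p) = p" for p
    using row[of v "fst p" p, OF perm] row[of "\<lambda>k. inv (v k)" "fst p" p, OF perm']
      permutes_inverses[OF perm, of "fst p"]
    by (simp_all add: glue_def)
  have bij: "bij (glue v)"
    by (rule o_bij[of "glue (\<lambda>k. inv (v k))"]; rule ext) (simp_all add: inv)
  have outside: "glue v p = p" if "p \<notin> positions e m" for p
  proof (cases "fst p < e")
    case True
    then have "p \<notin> {fst p} \<times> {1..m (fst p)}"
      using that by (cases p) (simp add: mem_positions)
    then show ?thesis
      using permutes_not_in[OF perm[OF True]] by (simp add: glue_def)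
  qed (simp add: glue_def)
  have "\<exists>!x. glue v x = y" for y
    using bij by (auto simp only: bij_iff)
  then have "glue v permutes positions e m"
    unfolding permutes_def using outside by blast
  then have mem: "glue v \<in> row_group e m"
    by (rule row_groupI) (rule fst)
  have "(\<Sum>k<e. g k) = act_array (glue v) \<alpha>"
  proof (rule poly_mapping_eqI)
    fix p'
    obtain p where p: "p' = glue v p"
      using bij by (metis bij_pointE)
    obtain k j where kj: "p' = (k, j)"
      by (cases p')
    have fstp: "fst p = k"
      using fst(1)[of p] unfolding p[symmetric] kj by simp
    have "Poly_Mapping.lookup (\<Sum>k<e. g k) p' = Poly_Mapping.lookup \<alpha> p"
    proof (cases "k < e")
      case True
      then have p': "p' = v k p"
        using fstp p by (simp add: glue_def)
      have "Poly_Mapping.lookup (\<Sum>k<e. g k) p' = Poly_Mapping.lookup (g k) p'"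
        using sum_row_supported[OF keys_row_orbit[OF g], of e k j] True kj by simp
      also have "\<dots> = Poly_Mapping.lookup (row m k \<alpha>) p"
        unfolding gk[OF True] p' by (rule lookup_act_array_image[OF permutes_bij[OF perm[OF True]]])
      also have "\<dots> = Poly_Mapping.lookup \<alpha> p"
        using lookup_outside[OF \<alpha>, of p] fstp True
        by (cases p) (simp add: lookup_row mem_positions)
      finally show ?thesis .
    next
      case False
      then have "Poly_Mapping.lookup (\<Sum>k<e. g k) p' = 0"
        using sum_row_supported[OF keys_row_orbit[OF g], of e k j] kj by simp
      moreover have "Poly_Mapping.lookup \<alpha> p = 0"
        using lookup_outside[OF \<alpha>, of p] fstp False by (cases p) (simp add: mem_positions)
      ultimately show ?thesis by simp
    qed
    then show "Poly_Mapping.lookup (\<Sum>k<e. g k) p' = Poly_Mapping.lookup (act_array (glue v) \<alpha>) p'"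
      by (simp only: p lookup_act_array_image[OF bij])
  qed
  then show ?thesis
    unfolding row_perms_def using mem by blast
qed

lemma row_sum_row_orbits:
  assumes g: "\<And>k. k < e \<Longrightarrow> g k \<in> row_orbit m k \<alpha>" and "k < e"
  shows "row m k (\<Sum>k<e. g k) = g k"
proof (rule poly_mapping_eqI)
  fix p :: "nat \<times> nat"
  obtain k' j where p: "p = (k', j)"
    by (cases p)
  show "Poly_Mapping.lookup (row m k (\<Sum>k<e. g k)) p = Poly_Mapping.lookup (g k) p"
  proof (cases "p \<in> {k} \<times> {1..m k}")
    case True
    then show ?thesis
      using sum_row_supported[OF keys_row_orbit[OF g], of e k' j] \<open>k < e\<close>
      by (simp add: lookup_row p)
  next
    case False
    then have "p \<notin> Poly_Mapping.keys (g k)"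
      using keys_row_orbit[OF g[OF \<open>k < e\<close>]] by blast
    then show ?thesis
      using False by (simp add: lookup_row not_in_keys_iff_lookup_eq_zero)
  qed
qed

text \<open>
  Expanding the product over the rows gives a sum over families with one member from the orbit of
  each row, and cutting an array into its rows identifies these families with the row permutations
  of \<open>\<alpha>\<close>.
\<close>

lemma msym_eq_orbit_sum:
  assumes \<alpha>: "\<alpha> \<in> arrays e m"
  shows "msym e m \<alpha> = (\<Sum>\<beta>\<in>row_perms e m \<alpha>. xmon \<beta>)"
proof -
  have fin: "finite (row_orbit m k \<alpha>)" for k
    unfolding row_orbit_def by (intro finite_imageI finite_permutations finite_cartesian_product) simp_all
  have "msym e m \<alpha> = (\<Prod>k<e. \<Sum>\<beta>\<in>row_orbit m k \<alpha>. xmon \<beta>)"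
    by (simp only: msym_def monomial_symm_def row_orbit_def)
  also have "\<dots> = (\<Sum>g\<in>Pi\<^sub>E {..<e} (\<lambda>k. row_orbit m k \<alpha>). \<Prod>k<e. xmon (g k))"
    by (rule prod_sum_PiE) (simp_all add: fin)
  also have "\<dots> = (\<Sum>\<beta>\<in>row_perms e m \<alpha>. xmon \<beta>)"
  proof (rule sum.reindex_bij_witness[of _ "\<lambda>\<beta>. \<lambda>k\<in>{..<e}. row m k \<beta>" "\<lambda>g. \<Sum>k<e. g k"])
    fix g
    assume "g \<in> Pi\<^sub>E {..<e} (\<lambda>k. row_orbit m k \<alpha>)"
    then have g: "\<And>k. k < e \<Longrightarrow> g k \<in> row_orbit m k \<alpha>" and extensional: "g \<in> extensional {..<e}"
      by (simp_all only: PiE_iff lessThan_iff simp_thms)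
    show "(\<lambda>k\<in>{..<e}. row m k (\<Sum>k<e. g k)) = g"
    proof (rule ext)
      show "(\<lambda>k\<in>{..<e}. row m k (\<Sum>k<e. g k)) k = g k" for k
        using row_sum_row_orbits[OF g, of e k] extensional_arb[OF extensional, of k] by (cases "k < e") simp_all
    qed
    show "(\<Sum>k<e. g k) \<in> row_perms e m \<alpha>"
      by (rule sum_row_orbits_mem[OF \<alpha> g])
    show "xmon (\<Sum>k<e. g k) = (\<Prod>k<e. xmon (g k))"
      by (rule xmon_sum)
  next
    fix \<beta>
    assume \<beta>: "\<beta> \<in> row_perms e m \<alpha>"
    then show "(\<lambda>k\<in>{..<e}. row m k \<beta>) \<in> Pi\<^sub>E {..<e} (\<lambda>k. row_orbit m k \<alpha>)"
      using row_mem_row_orbit by (intro restrict_PiE_iff[THEN iffD2]) simp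
    show "(\<Sum>k<e. (\<lambda>k\<in>{..<e}. row m k \<beta>) k) = \<beta>"
      using sum_rows[OF row_perms_mem[OF \<alpha> \<beta>]] by simp
  qed
  finally show ?thesis .
qed

section \<open>Sorting the rows of an array\<close>

definition rows_decreasing :: "nat \<Rightarrow> (nat \<Rightarrow> nat) \<Rightarrow> array \<Rightarrow> bool" where
  "rows_decreasing e m \<alpha> \<longleftrightarrow> (\<forall>k<e. \<forall>i j. 1 \<le> i \<longrightarrow> i \<le> j \<longrightarrow> j \<le> m k \<longrightarrow>
     Poly_Mapping.lookup \<alpha> (k, j) \<le> Poly_Mapping.lookup \<alpha> (k, i))"

definition weight :: "nat \<Rightarrow> (nat \<Rightarrow> nat) \<Rightarrow> array \<Rightarrow> nat" where
  "weight e m \<alpha> = (\<Sum>p\<in>positions e m. Poly_Mapping.lookup \<alpha> p)"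

lemma partition_arrays_iff:
  "\<alpha> \<in> partition_arrays e m n \<longleftrightarrow> \<alpha> \<in> arrays e m \<and> rows_decreasing e m \<alpha> \<and> weight e m \<alpha> = n"
  by (simp only: partition_arrays_def rows_decreasing_def weight_def mem_Collect_eq)

lemma rows_decreasingD:
  assumes "rows_decreasing e m \<alpha>" "k < e" "1 \<le> i" "i \<le> j" "j \<le> m k"
  shows "Poly_Mapping.lookup \<alpha> (k, j) \<le> Poly_Mapping.lookup \<alpha> (k, i)"
  using assms by (simp only: rows_decreasing_def)

lemma sum_act_array:
  assumes "bij w"
  shows "(\<Sum>p\<in>S. f (Poly_Mapping.lookup (act_array w \<beta>) p)) = (\<Sum>p\<in>inv w ` S. f (Poly_Mapping.lookup \<beta> p))"
proof -
  have "inj_on (inv w) S"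
    using bij_is_inj[OF bij_imp_bij_inv[OF assms]] inj_on_subset by blast
  then show ?thesis
    by (simp add: sum.reindex lookup_act_array[OF assms])
qed

lemma sum_positions_act:
  assumes "w permutes positions e m"
  shows "(\<Sum>p\<in>positions e m. f (Poly_Mapping.lookup (act_array w \<beta>) p))
    = (\<Sum>p\<in>positions e m. f (Poly_Mapping.lookup \<beta> p))"
  by (simp only: sum_act_array[OF permutes_bij[OF assms]] permutes_image[OF permutes_inv[OF assms]])

lemma weight_act: "w permutes positions e m \<Longrightarrow> weight e m (act_array w \<beta>) = weight e m \<beta>"
  unfolding weight_def by (rule sum_positions_act)

lemma weight_add: "weight e m (\<beta> + \<gamma>) = weight e m \<beta> + weight e m \<gamma>"
  by (simp add: weight_def lookup_add sum.distrib)

lemma transpose_row_group: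
  assumes "(k, i) \<in> positions e m" "(k, j) \<in> positions e m"
  shows "Transposition.transpose (k, i) (k, j) \<in> row_group e m"
  by (rule row_groupI[OF permutes_swap_id[OF assms]]) (simp add: Transposition.transpose_def)

text \<open>
  Pairing with \<open>\<delta>\<close> is a potential on each orbit of the row group: swapping two entries that
  are in the wrong order increases it, so its maximizers have decreasing rows.
\<close>

definition potential :: "nat \<Rightarrow> (nat \<Rightarrow> nat) \<Rightarrow> array \<Rightarrow> nat" where
  "potential e m \<beta> = (\<Sum>p\<in>positions e m. Poly_Mapping.lookup \<beta> p * Poly_Mapping.lookup (delta e m) p)"

lemma rearrange_two:
  fixes a b c d :: nat
  assumes "a < b" "d < c"
  shows "a * c + b * d < b * c + a * d"
proof -
  obtain x y where "b = a + Suc x" "c = d + Suc y"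
    using assms by (metis add_Suc_right less_imp_Suc_add)
  then show ?thesis
    by (simp add: algebra_simps)
qed

lemma maximal_potential_decreasing:
  assumes max: "\<And>u. u \<in> row_group e m \<Longrightarrow> potential e m (act_array u \<beta>) \<le> potential e m \<beta>"
  shows "rows_decreasing e m \<beta>"
proof (rule ccontr)
  assume "\<not> rows_decreasing e m \<beta>"
  then obtain k i j where k: "k < e" "1 \<le> i" "i \<le> j" "j \<le> m k"
    and less: "Poly_Mapping.lookup \<beta> (k, i) < Poly_Mapping.lookup \<beta> (k, j)"
    unfolding rows_decreasing_def not_all not_imp not_le by (elim exE conjE) blast
  have ne: "i \<noteq> j"
    using less by auto
  let ?a = "(k, i)" and ?b = "(k, j)"
  let ?\<tau> = "Transposition.transpose ?a ?b"
  let ?P = "positions e m" and ?d = "Poly_Mapping.lookup (delta e m)"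
  have pos: "?a \<in> ?P" "?b \<in> ?P"
    using k by (simp_all add: mem_positions)
  note \<tau> = transpose_row_group[OF pos]
  have look: "Poly_Mapping.lookup (act_array ?\<tau> \<beta>) p = Poly_Mapping.lookup \<beta> (?\<tau> p)" for p
    by (simp add: lookup_act_array)
  define rest where "rest = (\<Sum>p\<in>?P - {?a} - {?b}. Poly_Mapping.lookup \<beta> p * ?d p)"
  have split: "(\<Sum>p\<in>?P. g p) = g ?a + (g ?b + (\<Sum>p\<in>?P - {?a} - {?b}. g p))" for g :: "nat \<times> nat \<Rightarrow> nat"
    using pos ne by (simp add: sum.remove[of ?P ?a] sum.remove[of "?P - {?a}" ?b])
  have "potential e m (act_array ?\<tau> \<beta>)
    = Poly_Mapping.lookup \<beta> ?b * ?d ?a + (Poly_Mapping.lookup \<beta> ?a * ?d ?b + rest)"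
  proof -
    have "(\<Sum>p\<in>?P - {?a} - {?b}. Poly_Mapping.lookup (act_array ?\<tau> \<beta>) p * ?d p) = rest"
      unfolding rest_def by (rule sum.cong[OF refl]) (simp add: look transpose_apply_other)
    then show ?thesis
      unfolding potential_def split by (simp add: look)
  qed
  moreover have "potential e m \<beta>
    = Poly_Mapping.lookup \<beta> ?a * ?d ?a + (Poly_Mapping.lookup \<beta> ?b * ?d ?b + rest)"
    unfolding potential_def split rest_def ..
  moreover have "?d ?b < ?d ?a"
    using pos k ne by (simp add: lookup_delta)
  ultimately have "potential e m \<beta> < potential e m (act_array ?\<tau> \<beta>)"
    using rearrange_two[OF less] by simp
  then show False
    using max[OF \<tau>] by simp
qed

lemma maximal_in_orbit:
  obtains u where "u \<in> row_group e m"
    "\<And>v. v \<in> row_group e m \<Longrightarrow> potential e m (act_array v \<gamma>) \<le> potential e m (act_array u \<gamma>)"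
    "rows_decreasing e m (act_array u \<gamma>)"
proof -
  let ?R = "row_group e m" and ?f = "\<lambda>u. potential e m (act_array u \<gamma>)"
  have "Max (?f ` ?R) \<in> ?f ` ?R"
    using finite_row_group[of e m] row_group_id[of e m] by (intro Max_in) auto
  then obtain u where u: "u \<in> ?R" "?f u = Max (?f ` ?R)"
    by auto
  have max: "?f v \<le> ?f u" if "v \<in> ?R" for v
    unfolding u(2) using that finite_row_group[of e m] by simp
  have "rows_decreasing e m (act_array u \<gamma>)"
  proof (rule maximal_potential_decreasing)
    fix v
    assume "v \<in> ?R"
    then show "potential e m (act_array v (act_array u \<gamma>)) \<le> ?f u"
      using max[OF row_group_comp[OF _ u(1)]] by (simp add: act_row_group_comp[OF _ u(1)])
  qed
  then show ?thesis
    using that u(1) max by blast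
qed

section \<open>Subset sums of decreasing arrays\<close>

lemma sum_le_initial_sum:
  fixes f :: "nat \<Rightarrow> nat"
  assumes "S \<subseteq> {1..n}" "\<And>i j. 1 \<le> i \<Longrightarrow> i \<le> j \<Longrightarrow> j \<le> n \<Longrightarrow> f j \<le> f i"
  shows "(\<Sum>j\<in>S. f j) \<le> (\<Sum>j=1..card S. f j)"
  using assms
proof (induction n arbitrary: S)
  case 0
  then show ?case by simp
next
  case (Suc n)
  show ?case
  proof (cases "Suc n \<in> S")
    case False
    then have "S \<subseteq> {1..n}"
      using Suc.prems(1) by (auto simp: le_Suc_eq)
    then show ?thesis
      by (rule Suc.IH) (rule Suc.prems(2), simp_all)
  next
    case True
    have fin: "finite S"
      using Suc.prems(1) finite_subset by blast
    have sub: "S - {Suc n} \<subseteq> {1..n}"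
      using Suc.prems(1) by (auto simp: le_Suc_eq)
    have card: "card S = Suc (card (S - {Suc n}))"
      using card.remove[OF fin True] .
    have "card S \<le> Suc n"
      using card_mono[OF _ Suc.prems(1)] by simp
    then have "f (Suc n) \<le> f (card S)"
      using card by (intro Suc.prems(2)) simp_all
    moreover have "(\<Sum>j\<in>S - {Suc n}. f j) \<le> (\<Sum>j=1..card (S - {Suc n}). f j)"
      by (rule Suc.IH[OF sub]) (rule Suc.prems(2), simp_all)
    ultimately show ?thesis
      unfolding sum.remove[OF fin True] card by simp
  qed
qed

text \<open>
  The set with as many cells in each row as \<open>S\<close>, pushed to the start of the row, where a decreasing
  array has its largest entries.
\<close>

definition initial_cells :: "nat \<Rightarrow> (nat \<times> nat) set \<Rightarrow> (nat \<times> nat) set" where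
  "initial_cells e S = (SIGMA k:{..<e}. {1..card {j. (k, j) \<in> S}})"

lemma subset_positions_Sigma:
  assumes "S \<subseteq> positions e m"
  shows "S = (SIGMA k:{..<e}. {j. (k, j) \<in> S})" "{j. (k, j) \<in> S} \<subseteq> {1..m k}"
    "finite {j. (k, j) \<in> S}"
proof -
  show sub: "{j. (k, j) \<in> S} \<subseteq> {1..m k}" for k
    using assms by (auto simp: positions_def)
  show "S = (SIGMA k:{..<e}. {j. (k, j) \<in> S})"
    using assms by (auto simp: positions_def)
  show "finite {j. (k, j) \<in> S}"
    by (rule finite_subset[OF sub]) simp
qed

lemma initial_cells_subset:
  assumes "S \<subseteq> positions e m"
  shows "initial_cells e S \<subseteq> positions e m"
proof -
  have "card {j. (k, j) \<in> S} \<le> m k" for k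
    using card_mono[OF _ subset_positions_Sigma(2)[OF assms]] by simp
  then show ?thesis
    unfolding initial_cells_def positions_def by (intro Sigma_mono) simp_all
qed

lemma card_initial_cells:
  assumes "S \<subseteq> positions e m"
  shows "card (initial_cells e S) = card S"
proof -
  have "card S = (\<Sum>k<e. card {j. (k, j) \<in> S})"
    by (subst subset_positions_Sigma(1)[OF assms], rule card_SigmaI)
      (simp_all add: subset_positions_Sigma(3)[OF assms])
  moreover have "card (initial_cells e S) = (\<Sum>k<e. card {1..card {j. (k, j) \<in> S}})"
    unfolding initial_cells_def by (rule card_SigmaI) simp_all
  ultimately show ?thesis by simp
qed

lemma sum_le_initial_cells:
  assumes S: "S \<subseteq> positions e m" and \<alpha>: "rows_decreasing e m \<alpha>"
  shows "(\<Sum>p\<in>S. Poly_Mapping.lookup \<alpha> p) \<le> (\<Sum>p\<in>initial_cells e S. Poly_Mapping.lookup \<alpha> p)"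
proof -
  have "(\<Sum>p\<in>S. Poly_Mapping.lookup \<alpha> p)
    = (\<Sum>p\<in>(SIGMA k:{..<e}. {j. (k, j) \<in> S}). Poly_Mapping.lookup \<alpha> p)"
    by (rule arg_cong[OF subset_positions_Sigma(1)[OF S]])
  also have "\<dots> = (\<Sum>k<e. \<Sum>j\<in>{j. (k, j) \<in> S}. Poly_Mapping.lookup \<alpha> (k, j))"
    by (subst sum.Sigma) (simp_all add: subset_positions_Sigma(3)[OF S] split_def)
  also have "\<dots> \<le> (\<Sum>k<e. \<Sum>j=1..card {j. (k, j) \<in> S}. Poly_Mapping.lookup \<alpha> (k, j))"
  proof (rule sum_mono)
    fix k
    assume "k \<in> {..<e}"
    then show "(\<Sum>j\<in>{j. (k, j) \<in> S}. Poly_Mapping.lookup \<alpha> (k, j))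
      \<le> (\<Sum>j=1..card {j. (k, j) \<in> S}. Poly_Mapping.lookup \<alpha> (k, j))"
      by (intro sum_le_initial_sum[OF subset_positions_Sigma(2)[OF S]] rows_decreasingD[OF \<alpha>]) simp_all
  qed
  also have "\<dots> = (\<Sum>p\<in>initial_cells e S. Poly_Mapping.lookup \<alpha> p)"
    unfolding initial_cells_def by (subst sum.Sigma) (simp_all add: split_def)
  finally show ?thesis .
qed

lemma image_positions:
  assumes "w permutes positions e m" "S \<subseteq> positions e m"
  shows "w ` S \<subseteq> positions e m"
  using assms(2) permutes_in_image[OF assms(1)] by blast

lemma initial_cells_image:
  assumes w: "w \<in> row_group e m"
  shows "initial_cells e (w ` S) = initial_cells e S"
proof -
  have "card {j. (k, j) \<in> w ` S} = card {j. (k, j) \<in> S}" for k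
  proof -
    have w_pair: "w (k, j) = (k, snd (w (k, j)))" for j
      using row_groupD(4)[OF w, of "(k, j)"] by (cases "w (k, j)") simp
    have "inj_on (\<lambda>j. snd (w (k, j))) {j. (k, j) \<in> S}"
    proof (rule inj_onI)
      fix j j'
      assume "snd (w (k, j)) = snd (w (k, j'))"
      then have "w (k, j) = w (k, j')"
        by (subst (1 2) w_pair) simp
      then show "j = j'"
        using bij_is_inj[OF row_groupD(2)[OF w]] by (simp add: inj_eq)
    qed
    moreover have "{j. (k, j) \<in> w ` S} = (\<lambda>j. snd (w (k, j))) ` {j. (k, j) \<in> S}"
    proof (rule set_eqI)
      fix j
      have "j \<in> (\<lambda>j. snd (w (k, j))) ` {j. (k, j) \<in> S}" if "(k, j) = w p" "p \<in> S" for p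
      proof -
        have "fst p = k"
          using row_groupD(4)[OF w, of p] unfolding that(1)[symmetric] by simp
        then have p: "p = (k, snd p)"
          by (cases p) simp
        have "j = snd (w (k, snd p))" "(k, snd p) \<in> S"
          using that unfolding p[symmetric] by (simp_all add: that(1)[symmetric])
        then show ?thesis by blast
      qed
      moreover have "(k, snd (w (k, j'))) \<in> w ` S" if "(k, j') \<in> S" for j'
        unfolding w_pair[symmetric] using that by (rule imageI)
      ultimately show "j \<in> {j. (k, j) \<in> w ` S} \<longleftrightarrow> j \<in> (\<lambda>j. snd (w (k, j))) ` {j. (k, j) \<in> S}"
        by blast
    qed
    ultimately show ?thesis
      by (simp add: card_image)
  qed
  then show ?thesis
    by (simp only: initial_cells_def)
qed

lemma sum_act_le_initial_cells:
  assumes S: "S \<subseteq> positions e m" and \<alpha>: "rows_decreasing e m \<alpha>" and w: "w \<in> row_group e m"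
  shows "(\<Sum>p\<in>S. Poly_Mapping.lookup (act_array w \<alpha>) p) \<le> (\<Sum>p\<in>initial_cells e S. Poly_Mapping.lookup \<alpha> p)"
proof -
  note inv = row_group_inv[OF w]
  have "(\<Sum>p\<in>S. Poly_Mapping.lookup (act_array w \<alpha>) p) = (\<Sum>p\<in>inv w ` S. Poly_Mapping.lookup \<alpha> p)"
    by (rule sum_act_array[OF row_groupD(2)[OF w]])
  also have "\<dots> \<le> (\<Sum>p\<in>initial_cells e (inv w ` S). Poly_Mapping.lookup \<alpha> p)"
    by (rule sum_le_initial_cells[OF image_positions[OF row_groupD(1)[OF inv] S] \<alpha>])
  finally show ?thesis
    unfolding initial_cells_image[OF inv] .
qed

lemma initial_cells_segment:
  assumes "k < e"
  shows "initial_cells e ({k} \<times> {1..c}) = {k} \<times> {1..c}"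
proof -
  have "{j. (k', j) \<in> {k} \<times> {1..c}} = (if k' = k then {1..c} else {})" for k'
    by auto
  then show ?thesis
    using assms by (auto simp: initial_cells_def split: if_splits)
qed

text \<open>
  An orbit of the row group contains only one array with decreasing rows, since the initial
  partial sums of a decreasing row are the largest sums of that many of its entries.
\<close>

lemma decreasing_unique:
  assumes \<alpha>: "\<alpha> \<in> arrays e m" "rows_decreasing e m \<alpha>"
    and w: "w \<in> row_group e m" and dec: "rows_decreasing e m (act_array w \<alpha>)"
  shows "act_array w \<alpha> = \<alpha>"
proof (rule poly_mapping_eqI)
  let ?\<beta> = "act_array w \<alpha>"
  fix p :: "nat \<times> nat"
  obtain k c where p: "p = (k, c)"
    by (cases p)
  show "Poly_Mapping.lookup ?\<beta> p = Poly_Mapping.lookup \<alpha> p"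
  proof (cases "p \<in> positions e m")
    case True
    then have k: "k < e" "1 \<le> c" "c \<le> m k"
      by (simp_all add: p mem_positions)
    have partial: "(\<Sum>j=1..c'. Poly_Mapping.lookup ?\<beta> (k, j)) = (\<Sum>j=1..c'. Poly_Mapping.lookup \<alpha> (k, j))"
      if "c' \<le> m k" for c'
    proof -
      have S: "{k} \<times> {1..c'} \<subseteq> positions e m"
        unfolding positions_def using k(1) that by (intro subsetI) auto
      have "(\<Sum>p\<in>{k} \<times> {1..c'}. Poly_Mapping.lookup ?\<beta> p) \<le> (\<Sum>p\<in>{k} \<times> {1..c'}. Poly_Mapping.lookup \<alpha> p)"
        using sum_act_le_initial_cells[OF S \<alpha>(2) w] by (simp only: initial_cells_segment[OF k(1)])
      moreover have "(\<Sum>p\<in>{k} \<times> {1..c'}. Poly_Mapping.lookup \<alpha> p) \<le> (\<Sum>p\<in>{k} \<times> {1..c'}. Poly_Mapping.lookup ?\<beta> p)"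
        using sum_act_le_initial_cells[OF S dec row_group_inv[OF w]]
        by (simp only: initial_cells_segment[OF k(1)] act_array_inv[OF row_groupD(2)[OF w]])
      ultimately have "(\<Sum>p\<in>{k} \<times> {1..c'}. Poly_Mapping.lookup ?\<beta> p) = (\<Sum>p\<in>{k} \<times> {1..c'}. Poly_Mapping.lookup \<alpha> p)"
        by (rule order.antisym)
      moreover have "(\<Sum>p\<in>{k} \<times> {1..c'}. f p) = (\<Sum>j=1..c'. f (k, j))" for f :: "nat \<times> nat \<Rightarrow> nat"
      proof -
        have "{k} \<times> {1..c'} = Pair k ` {1..c'}"
          by auto
        then show ?thesis
          by (simp add: sum.reindex inj_on_def)
      qed
      ultimately show ?thesis by simp
    qed
    obtain d where d: "c = Suc d"
      using k(2) by (cases c) simp_all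
    show ?thesis
      using partial[of c] partial[of d] k(3) unfolding p d by simp
  next
    case False
    then show ?thesis
      by (simp only: lookup_outside[OF \<alpha>(1) False] lookup_outside[OF act_row_group_mem[OF w \<alpha>(1)] False])
  qed
qed

text \<open>
  Some element of the orbit maximizes the potential, and it has decreasing rows, so it is \<open>\<kappa>\<close>.
  Any other maximizer would have decreasing rows as well.
\<close>

lemma potential_less:
  assumes \<kappa>: "\<kappa> \<in> arrays e m" "rows_decreasing e m \<kappa>" and \<beta>: "\<beta> \<in> row_perms e m \<kappa>" "\<beta> \<noteq> \<kappa>"
  shows "potential e m \<beta> < potential e m \<kappa>"
proof -
  obtain w where w: "w \<in> row_group e m" and \<beta>w: "\<beta> = act_array w \<kappa>"
    using \<beta>(1) by (auto simp only: row_perms_def)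
  obtain u where u: "u \<in> row_group e m"
    and max: "\<And>v. v \<in> row_group e m \<Longrightarrow> potential e m (act_array v \<kappa>) \<le> potential e m (act_array u \<kappa>)"
    and dec: "rows_decreasing e m (act_array u \<kappa>)"
    using maximal_in_orbit[of e m \<kappa>] by blast
  have u\<kappa>: "act_array u \<kappa> = \<kappa>"
    by (rule decreasing_unique[OF \<kappa> u dec])
  have "\<not> potential e m \<kappa> \<le> potential e m \<beta>"
  proof
    assume le: "potential e m \<kappa> \<le> potential e m \<beta>"
    have "rows_decreasing e m \<beta>"
    proof (rule maximal_potential_decreasing)
      fix v
      assume v: "v \<in> row_group e m"
      have "potential e m (act_array v \<beta>) \<le> potential e m \<kappa>"
        using max[OF row_group_comp[OF v w]] unfolding u\<kappa> act_row_group_comp[OF v w] \<beta>w .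
      then show "potential e m (act_array v \<beta>) \<le> potential e m \<beta>"
        using le by simp
    qed
    then have "\<beta> = \<kappa>"
      unfolding \<beta>w by (rule decreasing_unique[OF \<kappa> w])
    then show False
      using \<beta>(2) by simp
  qed
  then show ?thesis by simp
qed

section \<open>Dominance of symbols\<close>

text \<open>
  The dominance order between the multisets of entries of two arrays, expressed by sums over sets of
  positions instead of sorted lists, so that permutations of the array and comparison row by row are
  easy to handle.
\<close>

definition majorized :: "nat \<Rightarrow> (nat \<Rightarrow> nat) \<Rightarrow> array \<Rightarrow> array \<Rightarrow> bool" where
  "majorized e m \<beta> \<gamma> \<longleftrightarrow> weight e m \<beta> = weight e m \<gamma> \<and>
     (\<forall>S\<subseteq>positions e m. \<exists>S'\<subseteq>positions e m. card S' = card S \<and>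
        (\<Sum>p\<in>S. Poly_Mapping.lookup \<beta> p) \<le> (\<Sum>p\<in>S'. Poly_Mapping.lookup \<gamma> p))"

lemma majorizedI:
  assumes "weight e m \<beta> = weight e m \<gamma>"
    and "\<And>S. S \<subseteq> positions e m \<Longrightarrow> \<exists>S'\<subseteq>positions e m. card S' = card S \<and>
        (\<Sum>p\<in>S. Poly_Mapping.lookup \<beta> p) \<le> (\<Sum>p\<in>S'. Poly_Mapping.lookup \<gamma> p)"
  shows "majorized e m \<beta> \<gamma>"
  unfolding majorized_def using assms by blast

lemma majorizedD:
  assumes "majorized e m \<beta> \<gamma>"
  shows "weight e m \<beta> = weight e m \<gamma>"
    and "S \<subseteq> positions e m \<Longrightarrow> \<exists>S'\<subseteq>positions e m. card S' = card S \<and>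
        (\<Sum>p\<in>S. Poly_Mapping.lookup \<beta> p) \<le> (\<Sum>p\<in>S'. Poly_Mapping.lookup \<gamma> p)"
  using assms unfolding majorized_def by blast+

lemma majorized_trans:
  assumes "majorized e m \<beta> \<gamma>" "majorized e m \<gamma> \<epsilon>"
  shows "majorized e m \<beta> \<epsilon>"
proof (rule majorizedI)
  show "weight e m \<beta> = weight e m \<epsilon>"
    using majorizedD(1)[OF assms(1)] majorizedD(1)[OF assms(2)] by simp
  fix S
  assume "S \<subseteq> positions e m"
  then obtain S' where S': "S' \<subseteq> positions e m" "card S' = card S"
    "(\<Sum>p\<in>S. Poly_Mapping.lookup \<beta> p) \<le> (\<Sum>p\<in>S'. Poly_Mapping.lookup \<gamma> p)"
    using majorizedD(2)[OF assms(1)] by blast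
  obtain S'' where S'': "S'' \<subseteq> positions e m" "card S'' = card S'"
    "(\<Sum>p\<in>S'. Poly_Mapping.lookup \<gamma> p) \<le> (\<Sum>p\<in>S''. Poly_Mapping.lookup \<epsilon> p)"
    using majorizedD(2)[OF assms(2) S'(1)] by blast
  have "card S'' = card S"
    using S'(2) S''(2) by simp
  moreover have "(\<Sum>p\<in>S. Poly_Mapping.lookup \<beta> p) \<le> (\<Sum>p\<in>S''. Poly_Mapping.lookup \<epsilon> p)"
    using S'(3) S''(3) by (rule order_trans)
  ultimately show "\<exists>S'\<subseteq>positions e m. card S' = card S \<and>
      (\<Sum>p\<in>S. Poly_Mapping.lookup \<beta> p) \<le> (\<Sum>p\<in>S'. Poly_Mapping.lookup \<epsilon> p)"
    using S''(1) by blast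
qed

lemma majorized_act:
  assumes "w permutes positions e m"
  shows "majorized e m (act_array w \<gamma>) \<gamma>"
proof (rule majorizedI)
  show "weight e m (act_array w \<gamma>) = weight e m \<gamma>"
    by (rule weight_act[OF assms])
  fix S
  assume S: "S \<subseteq> positions e m"
  note inv = permutes_inv[OF assms]
  have "card (inv w ` S) = card S"
    by (rule card_image[OF inj_on_subset[OF permutes_inj[OF inv] subset_UNIV]])
  moreover have "(\<Sum>p\<in>S. Poly_Mapping.lookup (act_array w \<gamma>) p) \<le> (\<Sum>p\<in>inv w ` S. Poly_Mapping.lookup \<gamma> p)"
    by (rule eq_refl[OF sum_act_array[OF permutes_bij[OF assms]]])
  ultimately show "\<exists>S'\<subseteq>positions e m. card S' = card S \<and>
      (\<Sum>p\<in>S. Poly_Mapping.lookup (act_array w \<gamma>) p) \<le> (\<Sum>p\<in>S'. Poly_Mapping.lookup \<gamma> p)"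
    using image_positions[OF inv S] by blast
qed

lemma rows_decreasing_delta: "rows_decreasing e m (delta e m)"
  by (auto simp: rows_decreasing_def lookup_delta mem_positions)

text \<open>
  Both summands on the right are decreasing along the rows. So for any set of cells, the cells pushed
  to the start of the rows have at least as large a sum in \<open>\<kappa>\<close> and in \<open>\<delta>\<close> at the same time.
\<close>

lemma majorized_permuted_plus_delta:
  assumes \<kappa>: "rows_decreasing e m \<kappa>" and w: "w \<in> row_group e m"
  shows "majorized e m (act_array w \<kappa> + delta e m) (\<kappa> + delta e m)"
proof (rule majorizedI)
  show "weight e m (act_array w \<kappa> + delta e m) = weight e m (\<kappa> + delta e m)"
    by (simp only: weight_add weight_act[OF row_groupD(1)[OF w]])
  fix S
  assume S: "S \<subseteq> positions e m"
  have "(\<Sum>p\<in>S. Poly_Mapping.lookup (act_array w \<kappa> + delta e m) p)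
    \<le> (\<Sum>p\<in>initial_cells e S. Poly_Mapping.lookup (\<kappa> + delta e m) p)"
    unfolding lookup_add sum.distrib
    by (rule add_mono[OF sum_act_le_initial_cells[OF S \<kappa> w] sum_le_initial_cells[OF S rows_decreasing_delta]])
  then show "\<exists>S'\<subseteq>positions e m. card S' = card S \<and>
      (\<Sum>p\<in>S. Poly_Mapping.lookup (act_array w \<kappa> + delta e m) p)
        \<le> (\<Sum>p\<in>S'. Poly_Mapping.lookup (\<kappa> + delta e m) p)"
    using initial_cells_subset[OF S] card_initial_cells[OF S] by blast
qed

lemma descending_enumeration:
  fixes f :: "'a \<Rightarrow> nat"
  assumes "finite P"
  shows "\<exists>qs. distinct qs \<and> set qs = P \<and>
    rev (sorted_list_of_multiset (image_mset f (mset_set P))) = map f qs \<and>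
    (\<forall>i j. i \<le> j \<longrightarrow> j < length qs \<longrightarrow> f (qs ! j) \<le> f (qs ! i))"
proof -
  obtain xs where xs: "set xs = P" "distinct xs"
    using finite_distinct_list[OF assms] by blast
  let ?ys = "sort_key f xs"
  have "image_mset f (mset_set P) = mset (map f xs)"
    unfolding xs(1)[symmetric] by (simp add: mset_set_set[OF xs(2)])
  then have "sorted_list_of_multiset (image_mset f (mset_set P)) = sort (map f xs)"
    by (simp only: sorted_list_of_multiset_mset)
  also have "\<dots> = map f ?ys"
    by (rule properties_for_sort) simp_all
  finally have eq: "rev (sorted_list_of_multiset (image_mset f (mset_set P))) = map f (rev ?ys)"
    by (simp add: rev_map)
  have sorted: "sorted (map f ?ys)"
    by simp
  have desc: "f (rev ?ys ! j) \<le> f (rev ?ys ! i)" if "i \<le> j" "j < length (rev ?ys)" for i j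
  proof -
    have "map f ?ys ! (length ?ys - Suc j) \<le> map f ?ys ! (length ?ys - Suc i)"
      using that by (intro sorted_nth_mono[OF sorted]) simp_all
    then show ?thesis
      using that by (simp add: rev_nth)
  qed
  show ?thesis
    by (rule exI[of _ "rev ?ys"]) (use xs eq desc in simp)
qed

lemma subset_sum_le_take:
  fixes f :: "'a \<Rightarrow> nat"
  assumes "distinct qs" "S \<subseteq> set qs"
    and desc: "\<And>i j. i \<le> j \<Longrightarrow> j < length qs \<Longrightarrow> f (qs ! j) \<le> f (qs ! i)"
  shows "(\<Sum>p\<in>S. f p) \<le> sum_list (take (card S) (map f qs))"
proof -
  define I where "I = {j \<in> {1..length qs}. qs ! (j - 1) \<in> S}"
  have inj: "inj_on (\<lambda>j. qs ! (j - 1)) I"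
  proof (rule inj_onI)
    fix a b
    assume ab: "a \<in> I" "b \<in> I" "qs ! (a - 1) = qs ! (b - 1)"
    then have "a - 1 = b - 1"
      using nth_eq_iff_index_eq[OF assms(1), of "a - 1" "b - 1"] by (auto simp: I_def)
    then show "a = b"
      using ab by (auto simp: I_def)
  qed
  have image: "(\<lambda>j. qs ! (j - 1)) ` I = S"
  proof
    show "(\<lambda>j. qs ! (j - 1)) ` I \<subseteq> S"
      by (auto simp: I_def)
    show "S \<subseteq> (\<lambda>j. qs ! (j - 1)) ` I"
    proof
      fix p
      assume p: "p \<in> S"
      then obtain i where i: "i < length qs" "qs ! i = p"
        using assms(2) by (metis in_set_conv_nth subsetD)
      then have "Suc i \<in> I"
        using p by (simp add: I_def)
      then show "p \<in> (\<lambda>j. qs ! (j - 1)) ` I"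
        using i(2) by (intro image_eqI[of _ _ "Suc i"]) simp_all
    qed
  qed
  have card: "card I = card S"
    using card_image[OF inj] image by simp
  have le: "card S \<le> length qs"
    using card_mono[OF _ assms(2)] distinct_card[OF assms(1)] by simp
  have "(\<Sum>p\<in>S. f p) = (\<Sum>j\<in>I. f (qs ! (j - 1)))"
    unfolding image[symmetric] by (simp only: sum.reindex[OF inj] o_def)
  also have "\<dots> \<le> (\<Sum>j=1..card I. f (qs ! (j - 1)))"
    by (rule sum_le_initial_sum[of _ "length qs"]) (auto simp: I_def intro!: desc)
  also have "\<dots> = (\<Sum>i<card S. f (qs ! i))"
    unfolding card
    by (rule sum.reindex_bij_witness[of _ Suc "\<lambda>j. j - 1"]) auto
  also have "\<dots> = sum_list (take (card S) (map f qs))"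
    using le by (simp add: sum_list_sum_nth atLeast0LessThan)
  finally show ?thesis .
qed

text \<open>
  The first \<open>i\<close> entries of the sorted list of all entries have the largest sum among the sets
  of \<open>i\<close> entries, so comparing sums over sets of positions amounts to the dominance order.
\<close>

lemma majorized_imp_dominated:
  assumes "majorized e m (symbol e m \<beta>) (symbol e m \<alpha>)"
  shows "dominated (symbol_partition e m \<beta>) (symbol_partition e m \<alpha>)"
proof -
  let ?P = "positions e m"
  let ?f = "Poly_Mapping.lookup (symbol e m \<beta>)" and ?g = "Poly_Mapping.lookup (symbol e m \<alpha>)"
  obtain bs where bs_enum: "distinct bs \<and> set bs = ?P \<and>
      rev (sorted_list_of_multiset (image_mset ?f (mset_set ?P))) = map ?f bs \<and>
      (\<forall>i j. i \<le> j \<longrightarrow> j < length bs \<longrightarrow> ?f (bs ! j) \<le> ?f (bs ! i))"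
    using descending_enumeration[OF finite_positions[of e m], of ?f] by (rule exE)
  then have bs: "distinct bs" "set bs = ?P" "symbol_partition e m \<beta> = map ?f bs"
    unfolding symbol_partition_def entries_def by simp_all
  obtain as where as_enum: "distinct as \<and> set as = ?P \<and>
      rev (sorted_list_of_multiset (image_mset ?g (mset_set ?P))) = map ?g as \<and>
      (\<forall>i j. i \<le> j \<longrightarrow> j < length as \<longrightarrow> ?g (as ! j) \<le> ?g (as ! i))"
    using descending_enumeration[OF finite_positions[of e m], of ?g] by (rule exE)
  note as_desc = as_enum[THEN conjunct2, THEN conjunct2, THEN conjunct2, rule_format]
  from as_enum have as: "distinct as" "set as = ?P" "symbol_partition e m \<alpha> = map ?g as"
    unfolding symbol_partition_def entries_def by simp_all
  have len: "length bs = length as"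
    using distinct_card[OF bs(1)] distinct_card[OF as(1)] bs(2) as(2) by simp
  have "sum_list (map ?f bs) = sum_list (map ?g as)"
    using majorizedD(1)[OF assms]
    by (simp add: sum_list_distinct_conv_sum_set bs as weight_def)
  moreover have "sum_list (take i (map ?f bs)) \<le> sum_list (take i (map ?g as))" for i
  proof -
    let ?S = "set (take i bs)"
    have "?S \<subseteq> ?P"
      using set_take_subset bs(2) by fast
    then obtain S' where S': "S' \<subseteq> ?P" "card S' = card ?S" "(\<Sum>p\<in>?S. ?f p) \<le> (\<Sum>p\<in>S'. ?g p)"
      using majorizedD(2)[OF assms] by blast
    have card: "card S' = min i (length as)"
      unfolding S'(2) using distinct_card[OF distinct_take[OF bs(1)], of i] len by (simp add: min.commute)
    have "sum_list (take i (map ?f bs)) = (\<Sum>p\<in>?S. ?f p)"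
      by (simp add: take_map sum_list_distinct_conv_sum_set distinct_take bs(1))
    also have "\<dots> \<le> sum_list (take (card S') (map ?g as))"
    proof (rule order_trans[OF S'(3)])
      show "(\<Sum>p\<in>S'. ?g p) \<le> sum_list (take (card S') (map ?g as))"
        by (rule subset_sum_le_take[of as S' ?g]) (use as(1,2) S'(1) as_desc in simp_all)
    qed
    also have "take (card S') (map ?g as) = take i (map ?g as)"
      unfolding card by (cases "i \<le> length as") (simp_all add: min_def)
    finally show ?thesis .
  qed
  ultimately show ?thesis
    unfolding dominated_def bs(3) as(3) by blast
qed

lemma symbol_partition_eq_imp_similar:
  assumes "symbol_partition e m \<beta> = symbol_partition e m \<alpha>"
  shows "similar e m \<beta> \<alpha>"
proof -
  have "sorted_list_of_multiset (entries e m (symbol e m \<beta>)) = sorted_list_of_multiset (entries e m (symbol e m \<alpha>))"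
    using assms by (simp add: symbol_partition_def)
  then have "mset (sorted_list_of_multiset (entries e m (symbol e m \<beta>)))
    = mset (sorted_list_of_multiset (entries e m (symbol e m \<alpha>)))"
    by (rule arg_cong)
  then show ?thesis
    by (simp add: similar_def)
qed

section \<open>Alternants\<close>

lemma ratqt_double_zero: "c = 0" if "c + c = (0 :: ratqt)"
proof -
  have "(1 + 1 :: complex poly poly) \<noteq> 0"
    by simp
  then have "to_fract (1 + 1 :: complex poly poly) \<noteq> 0"
    by (simp only: to_fract_eq_0_iff not_False_eq_True)
  then have "(1 + 1 :: ratqt) \<noteq> 0"
    by (simp only: to_fract_add to_fract_1 not_False_eq_True)
  moreover have "(1 + 1) * c = 0"
    using that by (simp only: distrib_right mult_1)
  ultimately show ?thesis
    by (simp only: mult_eq_0_iff simp_thms)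
qed

text \<open>
  The transposition of two equal entries fixes \<open>\<gamma>\<close> and changes the sign of the alternant.
\<close>

lemma antisymm_repeated_entry:
  assumes pos: "(k, i) \<in> positions e m" "(k, j) \<in> positions e m" "i \<noteq> j"
    and eq: "Poly_Mapping.lookup \<gamma> (k, i) = Poly_Mapping.lookup \<gamma> (k, j)"
  shows "antisymm e m \<gamma> = 0"
proof -
  let ?\<tau> = "Transposition.transpose (k, i) (k, j)"
  have "act_array ?\<tau> \<gamma> = \<gamma>"
    by (rule poly_mapping_eqI) (auto simp: lookup_act_array Transposition.transpose_def eq)
  then have "antisymm e m \<gamma> = - antisymm e m \<gamma>"
    using antisymm_act[OF transpose_row_group[OF pos(1,2)], of \<gamma>] pos(3) by (simp add: sign_swap_id)
  \<comment> \<open>The characteristic is not two, which is checked on the coefficients.\<close>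
  then have "antisymm e m \<gamma> + antisymm e m \<gamma> = 0"
    by (simp only: eq_neg_iff_add_eq_0)
  then have "Poly_Mapping.lookup (antisymm e m \<gamma>) \<mu> + Poly_Mapping.lookup (antisymm e m \<gamma>) \<mu> = 0" for \<mu>
    by (metis lookup_add lookup_zero)
  then show ?thesis
    by (intro poly_mapping_eqI) (simp add: ratqt_double_zero)
qed

lemma strictly_decreasing_gap:
  fixes f :: "nat \<Rightarrow> nat"
  assumes "\<And>i j. 1 \<le> i \<Longrightarrow> i < j \<Longrightarrow> j \<le> n \<Longrightarrow> f j < f i" and "i \<le> j" "1 \<le> i" "j \<le> n"
  shows "f j + (j - i) \<le> f i"
  using assms(2,4)
proof (induction j rule: dec_induct)
  case base
  then show ?case by simp
next
  case (step j)
  have "f (Suc j) < f j"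
    using step assms(3) by (intro assms(1)) simp_all
  then show ?case
    using step by simp
qed

text \<open>
  An alternant either vanishes because of a repeated entry in a row, or is up to sign the
  alternant of an array with strictly decreasing rows, and these are the sums of \<open>\<delta>\<close> and an
  array with decreasing rows.
\<close>

lemma antisymm_zero_or_sorted:
  assumes \<gamma>: "\<gamma> \<in> arrays e m"
  shows "antisymm e m \<gamma> = 0 \<or> (\<exists>u\<in>row_group e m. \<exists>\<kappa>\<in>arrays e m. rows_decreasing e m \<kappa> \<and>
    act_array u \<gamma> = \<kappa> + delta e m)"
proof -
  obtain u where u: "u \<in> row_group e m" and dec: "rows_decreasing e m (act_array u \<gamma>)"
    using maximal_in_orbit[of e m \<gamma>] by blast
  let ?\<beta> = "act_array u \<gamma>"
  note \<beta> = act_row_group_mem[OF u \<gamma>]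
  show ?thesis
  proof (cases "\<exists>k i j. k < e \<and> 1 \<le> i \<and> i < j \<and> j \<le> m k \<and>
      Poly_Mapping.lookup ?\<beta> (k, i) = Poly_Mapping.lookup ?\<beta> (k, j)")
    case True
    then obtain k i j where k: "k < e" "1 \<le> i" "i < j" "j \<le> m k"
      and eq: "Poly_Mapping.lookup ?\<beta> (k, i) = Poly_Mapping.lookup ?\<beta> (k, j)"
      by (elim exE conjE)
    have "antisymm e m ?\<beta> = 0"
      by (rule antisymm_repeated_entry[OF _ _ _ eq]) (use k in \<open>simp_all add: mem_positions\<close>)
    then show ?thesis
      using antisymm_act[OF row_group_inv[OF u], of ?\<beta>] by (simp add: act_array_inv[OF row_groupD(2)[OF u]])
  next
    case False
    have strict: "Poly_Mapping.lookup ?\<beta> (k, j) < Poly_Mapping.lookup ?\<beta> (k, i)"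
      if "k < e" "1 \<le> i" "i < j" "j \<le> m k" for k i j
    proof -
      have "Poly_Mapping.lookup ?\<beta> (k, i) \<noteq> Poly_Mapping.lookup ?\<beta> (k, j)"
        using False that by blast
      then show ?thesis
        using rows_decreasingD[OF dec that(1,2) less_imp_le[OF that(3)] that(4)] by simp
    qed
    have gap: "Poly_Mapping.lookup ?\<beta> (k, j) + (j - i) \<le> Poly_Mapping.lookup ?\<beta> (k, i)"
      if "k < e" "1 \<le> i" "i \<le> j" "j \<le> m k" for k i j
      by (rule strictly_decreasing_gap[of "m k" "\<lambda>j. Poly_Mapping.lookup ?\<beta> (k, j)"])
        (use strict that in simp_all)
    have above: "Poly_Mapping.lookup (delta e m) p \<le> Poly_Mapping.lookup ?\<beta> p" for p
    proof (cases p)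
      case (Pair k i)
      show ?thesis
      proof (cases "(k, i) \<in> positions e m")
        case True
        then have "Poly_Mapping.lookup ?\<beta> (k, m k) + (m k - i) \<le> Poly_Mapping.lookup ?\<beta> (k, i)"
          by (intro gap) (simp_all add: mem_positions)
        then show ?thesis
          using True unfolding Pair by (simp only: lookup_delta if_True)
      next
        case False
        then show ?thesis
          by (simp add: Pair lookup_delta)
      qed
    qed
    \<comment> \<open>The subtraction does not truncate, since strictly decreasing entries dominate those of \<open>\<delta>\<close>.\<close>
    define \<kappa> where "\<kappa> = ?\<beta> - delta e m"
    have sum: "\<kappa> + delta e m = ?\<beta>"
      by (rule poly_mapping_eqI) (simp add: \<kappa>_def lookup_add lookup_minus above)
    have "Poly_Mapping.keys \<kappa> \<subseteq> Poly_Mapping.keys ?\<beta>"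
      unfolding \<kappa>_def by (rule subsetI) (simp add: in_keys_iff lookup_minus)
    then have "\<kappa> \<in> arrays e m"
      using \<beta> by (simp add: arrays_def)
    moreover have "rows_decreasing e m \<kappa>"
      unfolding rows_decreasing_def
    proof (intro allI impI)
      fix k i j
      assume k: "k < e" "1 \<le> i" "i \<le> j" "j \<le> m k"
      show "Poly_Mapping.lookup \<kappa> (k, j) \<le> Poly_Mapping.lookup \<kappa> (k, i)"
        using gap[of k i j] k by (simp add: \<kappa>_def lookup_minus lookup_delta mem_positions)
    qed
    ultimately show ?thesis
      using u sum[symmetric] by blast
  qed
qed

text \<open>
  The entries of \<open>\<delta>\<close> in a row are distinct, so only the identity contributes to the coefficient of
  \<open>x^\<delta>\<close>.
\<close>

lemma antisymm_delta_nonzero: "antisymm e m (delta e m) \<noteq> 0"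
proof -
  let ?\<delta> = "delta e m"
  have fixes_delta: "w = id" if w: "w \<in> row_group e m" and eq: "act_array w ?\<delta> = ?\<delta>" for w
  proof
    fix p :: "nat \<times> nat"
    show "w p = id p"
    proof (cases "p \<in> positions e m")
      case True
      obtain k j where p: "p = (k, j)"
        by (cases p)
      obtain j' where wp: "w p = (k, j')"
        using row_groupD(4)[OF w, of p] p by (cases "w p") simp
      have "(k, j') \<in> positions e m"
        unfolding wp[symmetric] by (simp only: permutes_in_image[OF row_groupD(1)[OF w]] True)
      moreover have "Poly_Mapping.lookup ?\<delta> (k, j') = Poly_Mapping.lookup ?\<delta> (k, j)"
        using lookup_act_array_image[OF row_groupD(2)[OF w], of ?\<delta> p] unfolding eq unfolding wp unfolding p .
      ultimately have "j' = j"
        using True unfolding p by (auto simp: lookup_delta mem_positions)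
      then show ?thesis
        unfolding wp by (simp only: p id_apply)
    next
      case False
      then show ?thesis
        using permutes_not_in[OF row_groupD(1)[OF w]] by simp
    qed
  qed
  have "Poly_Mapping.lookup (antisymm e m ?\<delta>) ?\<delta>
    = (\<Sum>w\<in>row_group e m. if w = id then 1 else 0)"
    unfolding antisymm_eq lookup_sum
  proof (rule sum.cong[OF refl])
    fix w
    assume w: "w \<in> row_group e m"
    have "Poly_Mapping.lookup (of_int (sign w) * xmon (act_array w ?\<delta>)) ?\<delta>
      = of_int (sign w) * (if act_array w ?\<delta> = ?\<delta> then 1 else 0)"
      by (simp only: const_of_int[symmetric] lookup_const_mult lookup_xmon)
    also have "\<dots> = (if w = id then 1 else 0)"
      using fixes_delta[OF w] by (cases "w = id") auto
    finally show "Poly_Mapping.lookup (of_int (sign w) * xmon (act_array w ?\<delta>)) ?\<delta>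
      = (if w = id then 1 else 0)" .
  qed
  also have "\<dots> = 1"
    by (simp add: sum.delta finite_row_group row_group_id)
  finally show ?thesis
    by auto
qed

section \<open>Straightening\<close>

text \<open>
  The combinations of monomial symmetric polynomials of weight \<open>n\<close> whose symbols are dominated by
  \<open>\<gamma>\<close>. Equality of the entries is included, so this covers both alternatives in the
  triangularity statement: similar symbols and smaller ones.
\<close>

definition lower_span :: "nat \<Rightarrow> (nat \<Rightarrow> nat) \<Rightarrow> nat \<Rightarrow> array \<Rightarrow> xpoly set" where
  "lower_span e m n \<gamma> = {f. \<exists>b. f = (\<Sum>\<beta>\<in>partition_arrays e m n. const (b \<beta>) * msym e m \<beta>) \<and>
     (\<forall>\<beta>\<in>partition_arrays e m n. b \<beta> \<noteq> 0 \<longrightarrow> majorized e m (\<beta> + delta e m) \<gamma>)}"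

lemma lower_spanI:
  assumes "f = (\<Sum>\<beta>\<in>partition_arrays e m n. const (b \<beta>) * msym e m \<beta>)"
    and "\<And>\<beta>. \<beta> \<in> partition_arrays e m n \<Longrightarrow> b \<beta> \<noteq> 0 \<Longrightarrow> majorized e m (\<beta> + delta e m) \<gamma>"
  shows "f \<in> lower_span e m n \<gamma>"
  unfolding lower_span_def using assms by blast

lemma lower_spanE:
  assumes "f \<in> lower_span e m n \<gamma>"
  obtains b where "f = (\<Sum>\<beta>\<in>partition_arrays e m n. const (b \<beta>) * msym e m \<beta>)"
    "\<And>\<beta>. \<beta> \<in> partition_arrays e m n \<Longrightarrow> b \<beta> \<noteq> 0 \<Longrightarrow> majorized e m (\<beta> + delta e m) \<gamma>"
  using assms unfolding lower_span_def by blast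

lemma lower_span_zero: "0 \<in> lower_span e m n \<gamma>"
  by (rule lower_spanI[where b = "\<lambda>_. 0"]) simp_all

lemma lower_span_add:
  assumes "f \<in> lower_span e m n \<gamma>" "g \<in> lower_span e m n \<gamma>"
  shows "f + g \<in> lower_span e m n \<gamma>"
proof -
  obtain b where b: "f = (\<Sum>\<beta>\<in>partition_arrays e m n. const (b \<beta>) * msym e m \<beta>)"
    "\<And>\<beta>. \<beta> \<in> partition_arrays e m n \<Longrightarrow> b \<beta> \<noteq> 0 \<Longrightarrow> majorized e m (\<beta> + delta e m) \<gamma>"
    using lower_spanE[OF assms(1)] by blast
  obtain c where c: "g = (\<Sum>\<beta>\<in>partition_arrays e m n. const (c \<beta>) * msym e m \<beta>)"
    "\<And>\<beta>. \<beta> \<in> partition_arrays e m n \<Longrightarrow> c \<beta> \<noteq> 0 \<Longrightarrow> majorized e m (\<beta> + delta e m) \<gamma>"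
    using lower_spanE[OF assms(2)] by blast
  show ?thesis
  proof (rule lower_spanI[where b = "\<lambda>\<beta>. b \<beta> + c \<beta>"])
    show "f + g = (\<Sum>\<beta>\<in>partition_arrays e m n. const (b \<beta> + c \<beta>) * msym e m \<beta>)"
      by (simp only: b(1) c(1) const_add distrib_right sum.distrib)
    fix \<beta>
    assume "\<beta> \<in> partition_arrays e m n" "b \<beta> + c \<beta> \<noteq> 0"
    moreover from this have "b \<beta> \<noteq> 0 \<or> c \<beta> \<noteq> 0"
      by auto
    ultimately show "majorized e m (\<beta> + delta e m) \<gamma>"
      using b(2) c(2) by blast
  qed
qed

lemma lower_span_scale:
  assumes "f \<in> lower_span e m n \<gamma>"
  shows "const a * f \<in> lower_span e m n \<gamma>"
proof -
  obtain b where b: "f = (\<Sum>\<beta>\<in>partition_arrays e m n. const (b \<beta>) * msym e m \<beta>)"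
    "\<And>\<beta>. \<beta> \<in> partition_arrays e m n \<Longrightarrow> b \<beta> \<noteq> 0 \<Longrightarrow> majorized e m (\<beta> + delta e m) \<gamma>"
    using lower_spanE[OF assms] by blast
  show ?thesis
  proof (rule lower_spanI[where b = "\<lambda>\<beta>. a * b \<beta>"])
    show "const a * f = (\<Sum>\<beta>\<in>partition_arrays e m n. const (a * b \<beta>) * msym e m \<beta>)"
      by (simp only: b(1) const_mult sum_distrib_left mult.assoc)
  qed (simp add: b(2))
qed

lemma lower_span_sum:
  "(\<And>x. x \<in> A \<Longrightarrow> f x \<in> lower_span e m n \<gamma>) \<Longrightarrow> sum f A \<in> lower_span e m n \<gamma>"
  by (induction A rule: infinite_finite_induct) (simp_all add: lower_span_zero lower_span_add)

lemma lower_span_diff: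
  assumes "f \<in> lower_span e m n \<gamma>" "g \<in> lower_span e m n \<gamma>"
  shows "f - g \<in> lower_span e m n \<gamma>"
proof -
  have "f - g = f + const (of_int (- 1)) * g"
    unfolding const_of_int by simp
  then show ?thesis
    by (simp only: lower_span_add[OF assms(1) lower_span_scale[OF assms(2)]])
qed

lemma lower_span_mono:
  assumes "f \<in> lower_span e m n \<gamma>" "majorized e m \<gamma> \<gamma>'"
  shows "f \<in> lower_span e m n \<gamma>'"
proof -
  obtain b where b: "f = (\<Sum>\<beta>\<in>partition_arrays e m n. const (b \<beta>) * msym e m \<beta>)"
    "\<And>\<beta>. \<beta> \<in> partition_arrays e m n \<Longrightarrow> b \<beta> \<noteq> 0 \<Longrightarrow> majorized e m (\<beta> + delta e m) \<gamma>"
    using lower_spanE[OF assms(1)] by blast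
  show ?thesis
    by (rule lower_spanI[OF b(1)]) (rule majorized_trans[OF b(2) assms(2)])
qed

lemma finite_partition_arrays: "finite (partition_arrays e m n)"
proof -
  let ?r = "\<lambda>\<alpha>. restrict (Poly_Mapping.lookup \<alpha>) (positions e m)"
  have "?r ` partition_arrays e m n \<subseteq> Pi\<^sub>E (positions e m) (\<lambda>_. {..n})"
  proof
    fix g
    assume "g \<in> ?r ` partition_arrays e m n"
    then obtain \<alpha> where \<alpha>: "\<alpha> \<in> partition_arrays e m n" and g: "g = ?r \<alpha>"
      by blast
    have "Poly_Mapping.lookup \<alpha> p \<le> n" if "p \<in> positions e m" for p
      using member_le_sum[OF that _ finite_positions, of "Poly_Mapping.lookup \<alpha>"] \<alpha>
      by (simp add: partition_arrays_iff weight_def)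
    then show "g \<in> Pi\<^sub>E (positions e m) (\<lambda>_. {..n})"
      unfolding g by (intro restrict_PiE_iff[THEN iffD2]) simp
  qed
  moreover have "finite (Pi\<^sub>E (positions e m) (\<lambda>_. {..n}))"
    by (intro finite_PiE) simp_all
  ultimately have "finite (?r ` partition_arrays e m n)"
    by (rule finite_subset)
  moreover have "inj_on ?r (partition_arrays e m n)"
  proof (rule inj_onI)
    fix \<alpha> \<beta>
    assume \<alpha>\<beta>: "\<alpha> \<in> partition_arrays e m n" "\<beta> \<in> partition_arrays e m n" and eq: "?r \<alpha> = ?r \<beta>"
    show "\<alpha> = \<beta>"
    proof (rule poly_mapping_eqI)
      fix p
      show "Poly_Mapping.lookup \<alpha> p = Poly_Mapping.lookup \<beta> p"
      proof (cases "p \<in> positions e m")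
        case True
        then show ?thesis
          using fun_cong[OF eq, of p] by simp
      next
        case False
        then show ?thesis
          using \<alpha>\<beta> lookup_outside[of _ e m p] by (simp add: partition_arrays_iff)
      qed
    qed
  qed
  ultimately show ?thesis
    by (rule finite_imageD)
qed

lemma msym_in_lower_span:
  assumes "\<kappa> \<in> partition_arrays e m n" "majorized e m (\<kappa> + delta e m) \<gamma>"
  shows "msym e m \<kappa> \<in> lower_span e m n \<gamma>"
proof (rule lower_spanI[where b = "\<lambda>\<beta>. if \<beta> = \<kappa> then 1 else 0"])
  have "(\<Sum>\<beta>\<in>partition_arrays e m n. const (if \<beta> = \<kappa> then 1 else 0) * msym e m \<beta>)
    = (\<Sum>\<beta>\<in>partition_arrays e m n. if \<beta> = \<kappa> then msym e m \<beta> else 0)"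
    by (rule sum.cong[OF refl]) simp
  then show "msym e m \<kappa> = (\<Sum>\<beta>\<in>partition_arrays e m n. const (if \<beta> = \<kappa> then 1 else 0) * msym e m \<beta>)"
    by (simp add: sum.delta[OF finite_partition_arrays] assms(1))
qed (use assms(2) in \<open>simp split: if_splits\<close>)

definition square_sum :: "nat \<Rightarrow> (nat \<Rightarrow> nat) \<Rightarrow> array \<Rightarrow> nat" where
  "square_sum e m \<gamma> = (\<Sum>p\<in>positions e m. (Poly_Mapping.lookup \<gamma> p)\<^sup>2)"

lemma square_sum_act: "w permutes positions e m \<Longrightarrow> square_sum e m (act_array w \<gamma>) = square_sum e m \<gamma>"
  unfolding square_sum_def by (rule sum_positions_act)

lemma square_sum_add_delta:
  "square_sum e m (\<beta> + delta e m) = square_sum e m \<beta> + 2 * potential e m \<beta> + square_sum e m (delta e m)"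
  unfolding square_sum_def potential_def
  by (simp add: lookup_add power2_sum sum.distrib sum_distrib_left algebra_simps)

text \<open>
  For decreasing \<open>\<kappa>\<close> the product of the Vandermonde determinant and the orbit sum of \<open>\<kappa>\<close> is
  the alternant of \<open>\<kappa> + \<delta>\<close> plus the alternants of \<open>\<beta> + \<delta>\<close> for the other row permutations
  \<open>\<beta>\<close> of \<open>\<kappa>\<close>. These are dominated by \<open>\<kappa> + \<delta>\<close>, and their sums of squares are strictly smaller,
  since \<open>\<kappa>\<close> is the only maximizer of the pairing with \<open>\<delta>\<close>; so they can be straightened by
  induction.
\<close>

lemma antisymm_straighten:
  assumes "e \<ge> 1" "\<gamma> \<in> arrays e m" "weight e m \<gamma> = n + weight e m (delta e m)"
  shows "\<exists>f\<in>lower_span e m n \<gamma>. antisymm e m \<gamma> = antisymm e m (delta e m) * f"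
  using assms(2,3)
proof (induction "square_sum e m \<gamma>" arbitrary: \<gamma> rule: less_induct)
  case less
  let ?\<delta> = "delta e m"
  show ?case
    using antisymm_zero_or_sorted[OF less.prems(1)]
  proof (elim disjE bexE conjE)
    assume "antisymm e m \<gamma> = 0"
    then show ?thesis
      by (intro bexI[OF _ lower_span_zero]) simp
  next
    fix u \<kappa>
    assume u: "u \<in> row_group e m" and \<kappa>: "\<kappa> \<in> arrays e m" "rows_decreasing e m \<kappa>"
      and sorted: "act_array u \<gamma> = \<kappa> + ?\<delta>"
    note u_perm = row_groupD(1)[OF u]
    have below: "majorized e m (\<kappa> + ?\<delta>) \<gamma>"
      using majorized_act[OF u_perm, of \<gamma>] by (simp only: sorted)
    have "weight e m (\<kappa> + ?\<delta>) = weight e m \<gamma>"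
      using weight_act[OF u_perm, of \<gamma>] by (simp only: sorted)
    then have weight: "weight e m \<kappa> = n"
      using less.prems(2) by (simp add: weight_add)
    then have part: "\<kappa> \<in> partition_arrays e m n"
      using \<kappa> by (simp add: partition_arrays_iff)
    let ?R = "row_perms e m \<kappa> - {\<kappa>}"
    have "\<exists>f\<in>lower_span e m n \<gamma>. antisymm e m (\<beta> + ?\<delta>) = antisymm e m ?\<delta> * f" if "\<beta> \<in> ?R" for \<beta>
    proof -
      have \<beta>: "\<beta> \<in> row_perms e m \<kappa>" "\<beta> \<noteq> \<kappa>"
        using that by blast+
      obtain w where w: "w \<in> row_group e m" and \<beta>w: "\<beta> = act_array w \<kappa>"
        using \<beta>(1) by (auto simp only: row_perms_def)
      have "square_sum e m (\<beta> + ?\<delta>) < square_sum e m (\<kappa> + ?\<delta>)"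
        using potential_less[OF \<kappa> \<beta>] square_sum_act[OF row_groupD(1)[OF w], of \<kappa>]
        unfolding square_sum_add_delta \<beta>w by simp
      also have "\<dots> = square_sum e m \<gamma>"
        using square_sum_act[OF u_perm, of \<gamma>] by (simp only: sorted)
      finally have smaller: "square_sum e m (\<beta> + ?\<delta>) < square_sum e m \<gamma>" .
      have "weight e m (\<beta> + ?\<delta>) = n + weight e m ?\<delta>"
        using weight unfolding weight_add \<beta>w weight_act[OF row_groupD(1)[OF w]] by simp
      then obtain f where f: "f \<in> lower_span e m n (\<beta> + ?\<delta>)" "antisymm e m (\<beta> + ?\<delta>) = antisymm e m ?\<delta> * f"
        using less.hyps[OF smaller arrays_add[OF row_perms_mem[OF \<kappa>(1) \<beta>(1)] delta_mem]] by blast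
      have "majorized e m (\<beta> + ?\<delta>) \<gamma>"
        unfolding \<beta>w by (rule majorized_trans[OF majorized_permuted_plus_delta[OF \<kappa>(2) w] below])
      then show ?thesis
        using lower_span_mono[OF f(1)] f(2) by blast
    qed
    then obtain F where F: "\<And>\<beta>. \<beta> \<in> ?R \<Longrightarrow> F \<beta> \<in> lower_span e m n \<gamma>"
      "\<And>\<beta>. \<beta> \<in> ?R \<Longrightarrow> antisymm e m (\<beta> + ?\<delta>) = antisymm e m ?\<delta> * F \<beta>"
      by metis
    let ?f = "msym e m \<kappa> - (\<Sum>\<beta>\<in>?R. F \<beta>)"
    have "antisymm e m ?\<delta> * msym e m \<kappa> = (\<Sum>\<beta>\<in>row_perms e m \<kappa>. antisymm e m (\<beta> + ?\<delta>))"
      unfolding msym_eq_orbit_sum[OF \<kappa>(1)] by (rule antisymm_delta_times_orbit[OF assms(1) \<kappa>(1)])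
    also have "\<dots> = antisymm e m (\<kappa> + ?\<delta>) + (\<Sum>\<beta>\<in>?R. antisymm e m (\<beta> + ?\<delta>))"
      by (rule sum.remove[OF finite_row_perms row_perms_self])
    also have "(\<Sum>\<beta>\<in>?R. antisymm e m (\<beta> + ?\<delta>)) = antisymm e m ?\<delta> * (\<Sum>\<beta>\<in>?R. F \<beta>)"
      unfolding sum_distrib_left by (rule sum.cong[OF refl F(2)])
    finally have \<kappa>_eq: "antisymm e m (\<kappa> + ?\<delta>) = antisymm e m ?\<delta> * ?f"
      by (simp add: right_diff_distrib)
    have "\<gamma> = act_array (inv u) (\<kappa> + ?\<delta>)"
      unfolding sorted[symmetric] by (rule act_array_inv(2)[OF row_groupD(2)[OF u], symmetric])
    then have "antisymm e m \<gamma> = of_int (sign (inv u)) * antisymm e m (\<kappa> + ?\<delta>)"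
      using antisymm_act[OF row_group_inv[OF u], of "\<kappa> + ?\<delta>"] by simp
    also have "\<dots> = antisymm e m ?\<delta> * (const (of_int (sign (inv u))) * ?f)"
      by (simp only: \<kappa>_eq const_of_int mult.left_commute)
    finally have "antisymm e m \<gamma> = antisymm e m ?\<delta> * (const (of_int (sign (inv u))) * ?f)" .
    moreover have "const (of_int (sign (inv u))) * ?f \<in> lower_span e m n \<gamma>"
      by (intro lower_span_scale lower_span_diff msym_in_lower_span[OF part below] lower_span_sum F(1))
    ultimately show ?thesis
      by blast
  qed
qed

text \<open>
  The positions of \<open>\<beta> + \<delta>\<close> are only permuted by \<open>J\<close>, and \<open>\<beta>\<close> is a row permutation of the
  decreasing array \<open>\<alpha>\<close>. So every alternant in the numerator belongs to an array dominated by
  \<open>\<alpha> + \<delta>\<close>, and straightening stays below it.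
\<close>

lemma D_numerator_msym:
  assumes "e \<ge> 1" and \<alpha>: "\<alpha> \<in> partition_arrays e m n"
  shows "\<exists>f\<in>lower_span e m n (symbol e m \<alpha>).
    D_numerator e m s r (msym e m \<alpha>) = antisymm e m (delta e m) * f"
proof -
  let ?\<delta> = "delta e m" and ?R = "row_perms e m \<alpha>" and ?I = "index_sets e m r"
  have \<alpha>': "\<alpha> \<in> arrays e m" "rows_decreasing e m \<alpha>" "weight e m \<alpha> = n"
    using \<alpha> by (simp_all add: partition_arrays_iff)
  have "\<exists>f\<in>lower_span e m n (symbol e m \<alpha>).
      antisymm e m (act_array (cell_shift e s J) (\<beta> + ?\<delta>)) = antisymm e m ?\<delta> * f"
    if \<beta>: "\<beta> \<in> ?R" and J: "J \<in> ?I" for \<beta> J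
  proof -
    obtain w where w: "w \<in> row_group e m" and \<beta>w: "\<beta> = act_array w \<alpha>"
      using \<beta> by (auto simp only: row_perms_def)
    let ?\<gamma> = "act_array (cell_shift e s J) (\<beta> + ?\<delta>)"
    note perm = cell_shift_permutes[OF assms(1) J, of s]
    have "?\<gamma> \<in> arrays e m"
      by (rule act_array_mem[OF perm arrays_add[OF row_perms_mem[OF \<alpha>'(1) \<beta>] delta_mem]])
    moreover have "weight e m ?\<gamma> = n + weight e m ?\<delta>"
      by (simp only: weight_act[OF perm] weight_add \<beta>w weight_act[OF row_groupD(1)[OF w]] \<alpha>'(3))
    ultimately obtain f where f: "f \<in> lower_span e m n ?\<gamma>" "antisymm e m ?\<gamma> = antisymm e m ?\<delta> * f"
      using antisymm_straighten[OF assms(1)] by blast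
    have "majorized e m ?\<gamma> (symbol e m \<alpha>)"
      unfolding symbol_def \<beta>w
      by (rule majorized_trans[OF majorized_act[OF perm] majorized_permuted_plus_delta[OF \<alpha>'(2) w]])
    then show ?thesis
      using lower_span_mono[OF f(1)] f(2) by blast
  qed
  then obtain F where F: "\<And>\<beta> J. \<beta> \<in> ?R \<Longrightarrow> J \<in> ?I \<Longrightarrow> F \<beta> J \<in> lower_span e m n (symbol e m \<alpha>)"
    "\<And>\<beta> J. \<beta> \<in> ?R \<Longrightarrow> J \<in> ?I \<Longrightarrow>
      antisymm e m (act_array (cell_shift e s J) (\<beta> + ?\<delta>)) = antisymm e m ?\<delta> * F \<beta> J"
    by metis
  let ?c = "\<lambda>\<beta> J. const (tt ^ pairing e ?\<delta> J * qq ^ pairing e \<beta> J)"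
  have "D_numerator e m s r (msym e m \<alpha>)
    = (\<Sum>\<beta>\<in>?R. \<Sum>J\<in>?I. ?c \<beta> J * antisymm e m (act_array (cell_shift e s J) (\<beta> + ?\<delta>)))"
    unfolding msym_eq_orbit_sum[OF \<alpha>'(1)] by (rule D_numerator_orbit[OF assms(1) \<alpha>'(1)])
  also have "\<dots> = antisymm e m ?\<delta> * (\<Sum>\<beta>\<in>?R. \<Sum>J\<in>?I. ?c \<beta> J * F \<beta> J)"
    unfolding sum_distrib_left by (intro sum.cong refl) (simp only: F(2) mult.left_commute)
  finally show ?thesis
    by (intro bexI[of _ "\<Sum>\<beta>\<in>?R. \<Sum>J\<in>?I. ?c \<beta> J * F \<beta> J"] lower_span_sum lower_span_scale F(1))
qed

section \<open>Symmetric polynomials\<close>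

lemma symm_polysI:
  assumes "Poly_Mapping.keys f \<subseteq> arrays e m" "\<And>w. w \<in> row_group e m \<Longrightarrow> act_poly w f = f"
  shows "f \<in> symm_polys e m"
  unfolding symm_polys_def polys_def using assms by blast

lemma symm_polysD:
  assumes "f \<in> symm_polys e m"
  shows "Poly_Mapping.keys f \<subseteq> arrays e m" "w \<in> row_group e m \<Longrightarrow> act_poly w f = f"
  using assms unfolding symm_polys_def polys_def by blast+

lemma symm_polys_add:
  assumes "f \<in> symm_polys e m" "g \<in> symm_polys e m"
  shows "f + g \<in> symm_polys e m"
proof (rule symm_polysI)
  show "Poly_Mapping.keys (f + g) \<subseteq> arrays e m"
    using keys_add[of f g] symm_polysD(1)[OF assms(1)] symm_polysD(1)[OF assms(2)] by blast
  show "act_poly w (f + g) = f + g" if "w \<in> row_group e m" for w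
    by (simp only: linear_add[OF linear_act_poly] symm_polysD(2)[OF assms(1) that] symm_polysD(2)[OF assms(2) that])
qed

lemma symm_polys_scale:
  assumes "f \<in> symm_polys e m"
  shows "const c * f \<in> symm_polys e m"
proof (rule symm_polysI)
  have "Poly_Mapping.keys (const c * f) \<subseteq> Poly_Mapping.keys f"
    by (rule subsetI) (simp add: in_keys_iff lookup_const_mult)
  then show "Poly_Mapping.keys (const c * f) \<subseteq> arrays e m"
    using symm_polysD(1)[OF assms] by (rule subset_trans)
  show "act_poly w (const c * f) = const c * f" if "w \<in> row_group e m" for w
    by (simp only: linear_scale[OF linear_act_poly] symm_polysD(2)[OF assms that])
qed

lemma symm_polys_zero: "0 \<in> symm_polys e m"
  by (rule symm_polysI) (simp_all add: act_poly_def subst_def)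

lemma symm_polys_sum:
  "(\<And>x. x \<in> A \<Longrightarrow> f x \<in> symm_polys e m) \<Longrightarrow> sum f A \<in> symm_polys e m"
  by (induction A rule: infinite_finite_induct) (simp_all add: symm_polys_zero symm_polys_add)

lemma lookup_msym:
  assumes "\<alpha> \<in> arrays e m"
  shows "Poly_Mapping.lookup (msym e m \<alpha>) \<mu> = (if \<mu> \<in> row_perms e m \<alpha> then 1 else 0)"
  unfolding msym_eq_orbit_sum[OF assms] lookup_sum lookup_xmon
  by (simp add: sum.delta finite_row_perms)

lemma msym_symm:
  assumes "\<alpha> \<in> arrays e m"
  shows "msym e m \<alpha> \<in> symm_polys e m"
proof (rule symm_polysI)
  show "Poly_Mapping.keys (msym e m \<alpha>) \<subseteq> arrays e m"
    using row_perms_mem[OF assms] by (auto simp: in_keys_iff lookup_msym[OF assms] split: if_splits)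
  fix w
  assume w: "w \<in> row_group e m"
  show "act_poly w (msym e m \<alpha>) = msym e m \<alpha>"
    unfolding msym_eq_orbit_sum[OF assms] linear_sum[OF linear_act_poly]
    by (simp only: act_poly_xmon[OF row_groupD(2)[OF w]] sum_row_perms_act[OF w])
qed

lemma lower_span_symm: "f \<in> lower_span e m n \<gamma> \<Longrightarrow> f \<in> symm_polys e m"
  unfolding lower_span_def
  by (auto simp only: partition_arrays_iff intro!: symm_polys_sum symm_polys_scale msym_symm)

text \<open>
  The coefficients of a symmetric polynomial are constant on the orbits of the row group, and every
  orbit contains exactly one array with decreasing rows.
\<close>

lemma symm_polys_expand:
  assumes f: "f \<in> symm_polys e m"
  shows "f = (\<Sum>\<alpha>\<in>{\<alpha> \<in> Poly_Mapping.keys f. rows_decreasing e m \<alpha>}.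
    const (Poly_Mapping.lookup f \<alpha>) * msym e m \<alpha>)"
proof (rule poly_mapping_eqI)
  fix \<mu>
  let ?A = "{\<alpha> \<in> Poly_Mapping.keys f. rows_decreasing e m \<alpha>}"
  have A: "\<alpha> \<in> arrays e m" if "\<alpha> \<in> ?A" for \<alpha>
    using that symm_polysD(1)[OF f] by blast
  have "Poly_Mapping.lookup (\<Sum>\<alpha>\<in>?A. const (Poly_Mapping.lookup f \<alpha>) * msym e m \<alpha>) \<mu>
    = (\<Sum>\<alpha>\<in>?A. Poly_Mapping.lookup f \<alpha> * (if \<mu> \<in> row_perms e m \<alpha> then 1 else 0))"
    unfolding lookup_sum lookup_const_mult by (rule sum.cong[OF refl]) (simp only: lookup_msym[OF A])
  also have "\<dots> = Poly_Mapping.lookup f \<mu>"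
  proof (cases "\<mu> \<in> arrays e m")
    case False
    then have "\<mu> \<notin> row_perms e m \<alpha>" if "\<alpha> \<in> ?A" for \<alpha>
      using row_perms_mem[OF A[OF that]] by blast
    moreover have "Poly_Mapping.lookup f \<mu> = 0"
      using False symm_polysD(1)[OF f] not_in_keys_iff_lookup_eq_zero[of \<mu> f] by blast
    ultimately show ?thesis
      by simp
  next
    case True
    obtain u where u: "u \<in> row_group e m" and dec: "rows_decreasing e m (act_array u \<mu>)"
      using maximal_in_orbit[of e m \<mu>] by blast
    let ?\<nu> = "act_array u \<mu>"
    have look: "Poly_Mapping.lookup f ?\<nu> = Poly_Mapping.lookup f \<mu>"
      using lookup_act_poly[OF row_groupD(2)[OF u], of f \<mu>] by (simp only: symm_polysD(2)[OF f u])
    have orbit: "\<mu> \<in> row_perms e m \<alpha> \<longleftrightarrow> \<alpha> = ?\<nu>" if \<alpha>: "\<alpha> \<in> ?A" for \<alpha>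
    proof
      assume "\<mu> \<in> row_perms e m \<alpha>"
      then obtain w where w: "w \<in> row_group e m" and \<mu>: "\<mu> = act_array w \<alpha>"
        by (auto simp only: row_perms_def)
      have comp: "?\<nu> = act_array (u \<circ> w) \<alpha>"
        unfolding \<mu> by (rule act_row_group_comp[OF u w, symmetric])
      have "act_array (u \<circ> w) \<alpha> = \<alpha>"
        by (rule decreasing_unique[OF A[OF \<alpha>] _ row_group_comp[OF u w]])
          (use \<alpha> dec comp in simp_all)
      then show "\<alpha> = ?\<nu>"
        using comp by simp
    next
      assume \<alpha>\<nu>: "\<alpha> = ?\<nu>"
      have "\<mu> = act_array (inv u) \<alpha>"
        unfolding \<alpha>\<nu> by (rule act_array_inv(2)[OF row_groupD(2)[OF u], symmetric])
      then show "\<mu> \<in> row_perms e m \<alpha>"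
        unfolding row_perms_def using row_group_inv[OF u] by blast
    qed
    have "(\<Sum>\<alpha>\<in>?A. Poly_Mapping.lookup f \<alpha> * (if \<mu> \<in> row_perms e m \<alpha> then 1 else 0))
      = (\<Sum>\<alpha>\<in>?A. if \<alpha> = ?\<nu> then Poly_Mapping.lookup f \<alpha> else 0)"
      by (rule sum.cong[OF refl]) (simp only: orbit, simp)
    also have "\<dots> = (if ?\<nu> \<in> ?A then Poly_Mapping.lookup f ?\<nu> else 0)"
      by (rule sum.delta) simp
    also have "\<dots> = Poly_Mapping.lookup f \<mu>"
      using dec look by (simp add: in_keys_iff)
    finally show ?thesis .
  qed
  finally show "Poly_Mapping.lookup f \<mu> = Poly_Mapping.lookup
      (\<Sum>\<alpha>\<in>?A. const (Poly_Mapping.lookup f \<alpha>) * msym e m \<alpha>) \<mu>"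
    by simp
qed

lemma linear_D_numerator:
  assumes "e \<ge> 1"
  shows "scalar_linear (D_numerator e m s r)"
proof (rule scalar_linearI)
  note lin = linear_T_set[OF assms, of _ m r s qq]
  fix f g c
  show "D_numerator e m s r (f + g) = D_numerator e m s r f + D_numerator e m s r g"
    unfolding D_numerator_def
    by (simp only: linear_add[OF lin] distrib_left sum.distrib cong: sum.cong)
  show "D_numerator e m s r (const c * f) = const c * D_numerator e m s r f"
    unfolding D_numerator_def sum_distrib_left
    by (intro sum.cong refl) (simp only: linear_scale[OF lin] mult.left_commute)
qed

lemma D_numerator_symm:
  assumes "e \<ge> 1" and f: "f \<in> symm_polys e m"
  shows "\<exists>g\<in>symm_polys e m. D_numerator e m s r f = antisymm e m (delta e m) * g"
proof -
  let ?A = "{\<alpha> \<in> Poly_Mapping.keys f. rows_decreasing e m \<alpha>}"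
  have "\<exists>g\<in>symm_polys e m. D_numerator e m s r (msym e m \<alpha>) = antisymm e m (delta e m) * g"
    if "\<alpha> \<in> ?A" for \<alpha>
  proof -
    have "\<alpha> \<in> partition_arrays e m (weight e m \<alpha>)"
      using that symm_polysD(1)[OF f] by (auto simp only: partition_arrays_iff)
    then show ?thesis
      using D_numerator_msym[OF assms(1)] lower_span_symm by blast
  qed
  then have "\<forall>\<alpha>\<in>?A. \<exists>g. g \<in> symm_polys e m \<and>
      D_numerator e m s r (msym e m \<alpha>) = antisymm e m (delta e m) * g"
    by blast
  then obtain G where "\<forall>\<alpha>\<in>?A. G \<alpha> \<in> symm_polys e m \<and>
      D_numerator e m s r (msym e m \<alpha>) = antisymm e m (delta e m) * G \<alpha>"
    by (rule bchoice[THEN exE])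
  then have G: "\<And>\<alpha>. \<alpha> \<in> ?A \<Longrightarrow> G \<alpha> \<in> symm_polys e m"
    "\<And>\<alpha>. \<alpha> \<in> ?A \<Longrightarrow> D_numerator e m s r (msym e m \<alpha>) = antisymm e m (delta e m) * G \<alpha>"
    by blast+
  let ?g = "\<Sum>\<alpha>\<in>?A. const (Poly_Mapping.lookup f \<alpha>) * G \<alpha>"
  note lin = linear_D_numerator[OF assms(1), of m s r]
  have "D_numerator e m s r f = (\<Sum>\<alpha>\<in>?A. const (Poly_Mapping.lookup f \<alpha>) * D_numerator e m s r (msym e m \<alpha>))"
    by (subst symm_polys_expand[OF f]) (simp only: linear_sum[OF lin] linear_scale[OF lin])
  also have "\<dots> = antisymm e m (delta e m) * ?g"
    unfolding sum_distrib_left by (intro sum.cong refl) (simp only: G(2) mult.left_commute)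
  finally show ?thesis
    by (intro bexI[of _ ?g] symm_polys_sum symm_polys_scale G(1))
qed

section \<open>The action of the operators\<close>

lemma D_op_eq_quotient:
  assumes "D_numerator e m s r f = antisymm e m (delta e m) * g"
  shows "D_op e m s r f = to_fract g"
  unfolding D_op_eq assms using antisymm_delta_nonzero[of e m] by simp

lemma schur_eq:
  "schur e m (int_array \<gamma> - int_array (delta e m)) =
    to_fract (antisymm e m \<gamma>) / to_fract (antisymm e m (delta e m))"
proof -
  have "Poly_Mapping.map nat (int_array \<gamma>) = \<gamma>"
    by (rule poly_mapping_eqI) (simp add: int_array_def Poly_Mapping.map.rep_eq when_def)
  then show ?thesis
    by (simp add: schur_def)
qed

lemma D_op_msym:
  assumes "e \<ge> 1" and \<alpha>: "\<alpha> \<in> arrays e m"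
  shows "D_op e m s r (msym e m \<alpha>) =
    (\<Sum>\<beta>\<in>row_perms e m \<alpha>. \<Sum>J\<in>index_sets e m r.
       to_fract (const (tt ^ pairing e (delta e m) J * qq ^ pairing e \<beta> J)) *
       schur e m (int_array (shift_array e m s J (\<beta> + delta e m)) - int_array (delta e m)))"
proof -
  have "shift_array e m s J (\<beta> + delta e m) = act_array (cell_shift e s J) (\<beta> + delta e m)"
    if "\<beta> \<in> row_perms e m \<alpha>" "J \<in> index_sets e m r" for \<beta> J
    by (rule shift_array_eq[OF assms(1) that(2) arrays_add[OF row_perms_mem[OF \<alpha> that(1)] delta_mem]])
  then show ?thesis
    unfolding D_op_eq msym_eq_orbit_sum[OF \<alpha>] D_numerator_orbit[OF assms] to_fract_sum
      sum_divide_distrib schur_eq to_fract_mult times_divide_eq_right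
    by (intro sum.cong refl) simp
qed

lemma D_op_msym_triangular:
  assumes "e \<ge> 1" and \<alpha>: "\<alpha> \<in> partition_arrays e m n"
  shows "\<exists>b. D_op e m s r (msym e m \<alpha>) =
      (\<Sum>\<beta>\<in>partition_arrays e m n. to_fract (const (b \<beta>) * msym e m \<beta>)) \<and>
    (\<forall>\<beta>\<in>partition_arrays e m n. b \<beta> \<noteq> 0 \<longrightarrow> similar e m \<beta> \<alpha> \<or> symbol_less e m \<beta> \<alpha>)"
proof -
  obtain f where f: "f \<in> lower_span e m n (symbol e m \<alpha>)"
    and D: "D_numerator e m s r (msym e m \<alpha>) = antisymm e m (delta e m) * f"
    using D_numerator_msym[OF assms] by blast
  obtain b where b: "f = (\<Sum>\<beta>\<in>partition_arrays e m n. const (b \<beta>) * msym e m \<beta>)"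
    "\<And>\<beta>. \<beta> \<in> partition_arrays e m n \<Longrightarrow> b \<beta> \<noteq> 0 \<Longrightarrow>
      majorized e m (\<beta> + delta e m) (symbol e m \<alpha>)"
    using lower_spanE[OF f] by blast
  have "D_op e m s r (msym e m \<alpha>) =
      (\<Sum>\<beta>\<in>partition_arrays e m n. to_fract (const (b \<beta>) * msym e m \<beta>))"
    unfolding D_op_eq_quotient[OF D] b(1) by (rule to_fract_sum)
  moreover have "similar e m \<beta> \<alpha> \<or> symbol_less e m \<beta> \<alpha>"
    if "\<beta> \<in> partition_arrays e m n" "b \<beta> \<noteq> 0" for \<beta>
  proof -
    have "dominated (symbol_partition e m \<beta>) (symbol_partition e m \<alpha>)"
      by (rule majorized_imp_dominated) (use b(2)[OF that] in \<open>simp add: symbol_def\<close>)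
    then show ?thesis
      using symbol_partition_eq_imp_similar unfolding symbol_less_def by blast
  qed
  ultimately show ?thesis
    by blast
qed

text \<open>
  The preimages in the polynomial ring of the values of the operator are unique, so they inherit its
  linearity.
\<close>

lemma D_op_symm_operator:
  assumes "e \<ge> 1"
  shows "\<exists>L :: xpoly \<Rightarrow> xpoly.
    (\<forall>f\<in>symm_polys e m. L f \<in> symm_polys e m \<and> D_op e m s r f = to_fract (L f)) \<and>
    (\<forall>f\<in>symm_polys e m. \<forall>g\<in>symm_polys e m. L (f + g) = L f + L g) \<and>
    (\<forall>c. \<forall>f\<in>symm_polys e m. L (const c * f) = const c * L f)"
proof -
  let ?a = "antisymm e m (delta e m)"
  have "\<forall>f\<in>symm_polys e m. \<exists>g. g \<in> symm_polys e m \<and> D_numerator e m s r f = ?a * g"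
    using D_numerator_symm[OF assms] by blast
  then obtain L where "\<forall>f\<in>symm_polys e m. L f \<in> symm_polys e m \<and> D_numerator e m s r f = ?a * L f"
    by (rule bchoice[THEN exE])
  then have L: "\<And>f. f \<in> symm_polys e m \<Longrightarrow> L f \<in> symm_polys e m"
    "\<And>f. f \<in> symm_polys e m \<Longrightarrow> D_numerator e m s r f = ?a * L f"
    by blast+
  note lin = linear_D_numerator[OF assms, of m s r]
  have cancel: "g = h" if "?a * g = ?a * h" for g h
    using that antisymm_delta_nonzero[of e m] by simp
  show ?thesis
  proof (intro exI[of _ L] conjI ballI allI)
    fix f
    assume f: "f \<in> symm_polys e m"
    show "L f \<in> symm_polys e m"
      by (rule L(1)[OF f])
    show "D_op e m s r f = to_fract (L f)"
      by (rule D_op_eq_quotient[OF L(2)[OF f]])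
    show "L (f + g) = L f + L g" if g: "g \<in> symm_polys e m" for g
    proof (rule cancel)
      show "?a * L (f + g) = ?a * (L f + L g)"
        by (simp only: distrib_left L(2)[OF f, symmetric] L(2)[OF g, symmetric]
            L(2)[OF symm_polys_add[OF f g], symmetric] linear_add[OF lin])
    qed
    show "L (const c * f) = const c * L f" for c
    proof (rule cancel)
      show "?a * L (const c * f) = ?a * (const c * L f)"
        by (simp only: mult.left_commute[of ?a "const c"] L(2)[OF f, symmetric]
            L(2)[OF symm_polys_scale[OF f], symmetric] linear_scale[OF lin])
    qed
  qed
qed

theorem lemma2p4:
  fixes e r :: nat and m :: "nat \<Rightarrow> nat" and s :: int
  assumes "e \<ge> 1" and "\<forall>k<e. m k \<ge> 1"
    and "1 \<le> r" and "r \<le> Min (m ` {..<e})"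
    and "s \<in> {1, -1}"
  shows
    "(\<forall>\<alpha>\<in>multipartitions e m.
        D_op e m s r (msym e m \<alpha>) =
          (\<Sum>\<beta>\<in>row_perms e m \<alpha>. \<Sum>J\<in>index_sets e m r.
             to_fract (const (tt ^ pairing e (delta e m) J * qq ^ pairing e \<beta> J)) *
             schur e m (int_array (shift_array e m s J (\<beta> + delta e m)) - int_array (delta e m))))
     \<and>
     (\<forall>n. \<forall>\<alpha>\<in>partition_arrays e m n. \<exists>b :: array \<Rightarrow> ratqt.
        D_op e m s r (msym e m \<alpha>) =
          (\<Sum>\<beta>\<in>partition_arrays e m n. to_fract (const (b \<beta>) * msym e m \<beta>)) \<and>
        (\<forall>\<beta>\<in>partition_arrays e m n. b \<beta> \<noteq> 0 \<longrightarrow> similar e m \<beta> \<alpha> \<or> symbol_less e m \<beta> \<alpha>))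
     \<and>
     (\<exists>L :: xpoly \<Rightarrow> xpoly.
        (\<forall>f\<in>symm_polys e m. L f \<in> symm_polys e m \<and> D_op e m s r f = to_fract (L f)) \<and>
        (\<forall>f\<in>symm_polys e m. \<forall>g\<in>symm_polys e m. L (f + g) = L f + L g) \<and>
        (\<forall>c. \<forall>f\<in>symm_polys e m. L (const c * f) = const c * L f))"
proof (intro conjI ballI allI)
  fix \<alpha>
  assume "\<alpha> \<in> multipartitions e m"
  then have "\<alpha> \<in> arrays e m"
    by (auto simp only: multipartitions_def partition_arrays_iff)
  then show "D_op e m s r (msym e m \<alpha>) =
      (\<Sum>\<beta>\<in>row_perms e m \<alpha>. \<Sum>J\<in>index_sets e m r.
         to_fract (const (tt ^ pairing e (delta e m) J * qq ^ pairing e \<beta> J)) *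
         schur e m (int_array (shift_array e m s J (\<beta> + delta e m)) - int_array (delta e m)))"
    by (rule D_op_msym[OF assms(1)])
qed (rule D_op_msym_triangular[OF assms(1)] D_op_symm_operator[OF assms(1)], assumption?)+

end
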